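(* Let $n\ge1$, let $\lambda,\mu,\nu,\rho$ be partitions with $n$ parts, let $\kappa$ be a partition with $2n$ parts (parts may be zero), and let $k$ be an integer with $1\le|k|\le n$. For a $(\lambda/\mu)\circledast_k(\nu/\rho)$-peelable tableau $T$ of shape $\kappa$, let $(x_{i,1},x_{i,2},\ldots,x_{i,2n})$, for $0\le i\le 2n$, be the shape of the subtableau of $T$ formed by the entries at most $i$; put $\mu'=\mu\circledast_k\rho\in\mathbb{Z}^{2n}$ and $$y_{i,j}=\sum_{a=1}^{j}x_{i,a}+\sum_{a=1}^{i}\mu'_a\qquad(0\le i,j\le 2n).$$ Define $h_T:\Delta_{2n}\to\mathbb{Z}$ from the entries $y_{i,j}$ with $i\ge j$ by $h_T(i,j)=y_{i+j,\,j}$. Then $T\mapsto h_T$ is a bijection from the set of $(\lambda/\mu)\circledast_k(\nu/\rho)$-peelable tableaux of shape $\kappa$ onto $k\text{-}\mathrm{SkewHive}_{\lambda/\mu,\nu/\rho}^{\kappa}$.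
   Context: $\Delta_{2n}=\{(i,j)\in\mathbb{Z}_{\ge0}^2:i+j\le 2n\}$. Phased paths. For $1\le k\le n$ let $P_k$ be the word $W^k(NW)^{n-k}N^k$ and $P_{-k}$ the word $N^k(WN)^{n-k}W^k$; each has $2n$ letters, $n$ of them $N$ and $n$ of them $W$ (viewed as a lattice path from $(n,0)$ to $(0,n)$ with steps $N=(0,1)$, $W=(-1,0)$). Let $N_{P,i}$ (resp. $W_{P,i}$) be the position in the word $P$ of the $i$th $N$ (resp. $i$th $W$). Let $\mathrm{ht}_P(i)$ be (number of $N$'s) minus (number of $W$'s) among the first $i$ letters of $P$. Shuffling. For $\alpha,\beta\in\mathbb{Z}^n$ and $1\le|k|\le n$, $\alpha\circledast_k\beta\in\mathbb{Z}^{2n}$ is the sequence having $\alpha_i$ in position $W_{P_k,i}$ and $\beta_i$ in position $N_{P_k,i}$; e.g. for $k>0$ it is $(\alpha_1,\ldots,\alpha_k,\beta_1,\alpha_{k+1},\beta_2,\ldots,\alpha_n,\beta_{n-k+1},\ldots,\beta_n)$. Phased peelable tableaux. A $(\lambda/\mu)\circledast_k(\nu/\rho)$-peelable tableau is a semistandard Young tableau $T$ with content $(\lambda-\mu)\circledast_k(\nu-\rho)$ such that, for $1\le i<n$: (1) if rows $i$ and $i+1$ of $\lambda/\mu$ have $a_i$ columns in common, then $T$ has at least $a_i$ pairwise disjoint pairs consisting of one square with entry $W_{P_k,i}$ and one square with entry $W_{P_k,i+1}$, the former being Northeast of the latter; (2) if rows $i$ and $i+1$ of $\nu/\rho$ have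 $b_i$ columns in common, then $T$ has at least $b_i$ pairwise disjoint pairs consisting of one square with entry $N_{P_k,i}$ and one square with entry $N_{P_k,i+1}$, the former being Northeast of the latter. (Northeast is meant weakly: row index $\le$ and column index $\ge$, in English notation.) Phased skew hives. Let $\mathrm{Ht}_{P_k}(i,j)=\mathrm{ht}_{P_k}(2n-i-j)$ for $(i,j)\in\Delta_{2n}$. A unit triangle is a set of three points $\{w\pm(1,0,0),w\pm(0,1,0),w\pm(0,0,1)\}$ with $w\in\mathbb{Z}^3$ and some choice of signs (an equilateral triangle with side $\sqrt2$). A unit rhombus is the union of two coplanar unit triangles sharing an edge; the shared edge $\{x',y'\}$ is its short diagonal and the other two vertices $\{x,y\}$ its long diagonal. A $k$-phased skew hive is a function $h:\Delta_{2n}\to\mathbb{Z}$ such that, viewing $h$ as a function on the set $\{(i,j,\mathrm{Ht}_{P_k}(i,j)):(i,j)\in\Delta_{2n}\}\subset\mathbb{Z}^3$, one has $h(x')+h(y')\ge h(x)+h(y)$ for every unit rhombus all of whose vertices lie in that set. Define $h^{\uparrow}=(h_{0,1}-h_{0,0},\ldots,h_{0,2n}-h_{0,2n-1})$, $h^{\rightarrow}=(h_{1,0}-h_{0,0},\ldots,h_{2n,0}-h_{2n-1,0})$, $h^{\nwarrow}=(h_{2n-1,1}-h_{2n,0},\,h_{2n-2,2}-h_{2n-1,1},\ldots,h_{0,2n}-h_{1,2n-1})$. Then $k\text{-}\mathrm{SkewHive}_{\lambda/\mu,\nu/\rho}^{\kappa}$ is the set of $k$-phased skew hives with $h_{0,0}=0$,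 $h^\uparrow=\lambda\circledast_k\nu$, $h^\rightarrow=\mu\circledast_k\rho$ and $h^\nwarrow=\kappa$. *)

theory Defs
  imports "HOL-Analysis.Analysis"
begin

text \<open>
  Finite integer sequences are lists; the \<open>i\<close>-th term (counted from 1) of \<open>xs\<close> is \<open>xs ! (i - 1)\<close>.
  Functions on a finite set of squares or lattice points are extensional, that is, equal to
  \<open>undefined\<close> outside that set, so that each such function has exactly one representative.
\<close>

definition part_seq :: "nat \<Rightarrow> int list \<Rightarrow> bool" where
  "part_seq m xs \<longleftrightarrow> length xs = m \<and> sorted_wrt (\<ge>) xs \<and> (\<forall>x\<in>set xs. 0 \<le> x)"


subsection \<open>Phased paths and shuffling\<close>

datatype letter = North | West

definition phased_path :: "nat \<Rightarrow> int \<Rightarrow> letter list" where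
  "phased_path n k =
     (if k > 0
      then replicate (nat k) West @ concat (replicate (n - nat k) [North, West])
             @ replicate (nat k) North
      else replicate (nat (- k)) North @ concat (replicate (n - nat (- k)) [West, North])
             @ replicate (nat (- k)) West)"

text \<open>Position, counted from 1, of the \<open>i\<close>-th occurrence of the letter \<open>c\<close> in the word \<open>P\<close>.\<close>

definition letter_pos :: "letter list \<Rightarrow> letter \<Rightarrow> nat \<Rightarrow> nat" where
  "letter_pos P c i = filter (\<lambda>p. P ! (p - 1) = c) [1..<Suc (length P)] ! (i - 1)"

definition ht :: "letter list \<Rightarrow> nat \<Rightarrow> int" where
  "ht P i = int (count_list (take i P) North) - int (count_list (take i P) West)"

text \<open>
  The term in 0-based position \<open>p\<close> is taken from \<open>\<alpha>\<close> or \<open>\<beta>\<close> according to the letter there, the index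
  being the number of earlier occurrences of that letter. The lemmas \<open>shuffle_West\<close> and
  \<open>shuffle_North\<close> confirm that \<open>\<alpha>\<close> and \<open>\<beta>\<close> end up in the positions of the letters W and N.
\<close>

definition shuffle :: "nat \<Rightarrow> int \<Rightarrow> int list \<Rightarrow> int list \<Rightarrow> int list" where
  "shuffle n k \<alpha> \<beta> =
     (let P = phased_path n k in
      map (\<lambda>p. case P ! p of West \<Rightarrow> \<alpha> ! count_list (take p P) West
                           | North \<Rightarrow> \<beta> ! count_list (take p P) North) [0..<length P])"

lemma count_list_concat_replicate:
  "count_list (concat (replicate m xs)) c = m * count_list xs c"
  by (induction m) (auto simp: count_list_append)

lemma count_list_replicate: "count_list (replicate m d) c = (if c = d then m else 0)"
  by (induction m) auto

lemma count_phased_path: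
  assumes "1 \<le> \<bar>k\<bar>" "\<bar>k\<bar> \<le> int n"
  shows "count_list (phased_path n k) c = n"
  using assms
  by (cases c)
    (auto simp: phased_path_def count_list_append count_list_concat_replicate count_list_replicate)

lemma letter_pos_spec:
  assumes "1 \<le> i" "i \<le> count_list P c"
  shows "1 \<le> letter_pos P c i" "letter_pos P c i \<le> length P" "P ! (letter_pos P c i - 1) = c"
    "count_list (take (letter_pos P c i - 1) P) c = i - 1"
proof -
  have count: "length (filter (\<lambda>p. P ! (p - 1) = c) [1..<Suc q]) = count_list (take q P) c"
    if "q \<le> length P" for q
    using that
    by (induction q) (auto simp: take_Suc_conv_app_nth count_list_append)
  let ?F = "filter (\<lambda>p. P ! (p - 1) = c) [1..<Suc (length P)]"
  have i: "i - 1 < length ?F"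
    using assms count[of "length P"] by simp
  then have "letter_pos P c i \<in> set ?F"
    unfolding letter_pos_def by (rule nth_mem)
  then show *: "1 \<le> letter_pos P c i" "letter_pos P c i \<le> length P"
      "P ! (letter_pos P c i - 1) = c"
    by auto
  define q where "q = letter_pos P c i - 1"
  have q: "letter_pos P c i = Suc q" "q < length P" "P ! q = c"
    using * by (auto simp: q_def)
  have "[1..<Suc (length P)] = [1..<Suc q] @ [Suc q..<Suc (length P)]"
    using q(2) upt_add_eq_append[of 1 "Suc q" "length P - q"] by simp
  also have "[Suc q..<Suc (length P)] = Suc q # [Suc (Suc q)..<Suc (length P)]"
    using q(2) by (subst upt_rec) simp
  finally have "?F = filter (\<lambda>p. P ! (p - 1) = c) [1..<Suc q] @
      Suc q # filter (\<lambda>p. P ! (p - 1) = c) [Suc (Suc q)..<Suc (length P)]" (is "_ = ?A @ _")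
    using q(3) by simp
  then have "?F ! length ?A = Suc q" "length ?A < length ?F"
    by (simp_all add: nth_append)
  moreover have "?F ! (i - 1) = Suc q"
    using q(1) by (simp add: letter_pos_def)
  moreover have "distinct ?F"
    by simp
  ultimately have "length ?A = i - 1"
    using i nth_eq_iff_index_eq by metis
  then show "count_list (take (letter_pos P c i - 1) P) c = i - 1"
    using count[of q] q by simp
qed

lemma length_shuffle:
  assumes "1 \<le> \<bar>k\<bar>" "\<bar>k\<bar> \<le> int n"
  shows "length (shuffle n k \<alpha> \<beta>) = 2 * n"
  using assms by (auto simp: shuffle_def Let_def phased_path_def length_concat sum_list_replicate)

lemma shuffle_West:
  assumes "1 \<le> \<bar>k\<bar>" "\<bar>k\<bar> \<le> int n" "1 \<le> i" "i \<le> n"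
  shows "shuffle n k \<alpha> \<beta> ! (letter_pos (phased_path n k) West i - 1) = \<alpha> ! (i - 1)"
  using letter_pos_spec[of i "phased_path n k" West] assms count_phased_path[OF assms(1,2)]
  by (auto simp: shuffle_def Let_def)

lemma shuffle_North:
  assumes "1 \<le> \<bar>k\<bar>" "\<bar>k\<bar> \<le> int n" "1 \<le> i" "i \<le> n"
  shows "shuffle n k \<alpha> \<beta> ! (letter_pos (phased_path n k) North i - 1) = \<beta> ! (i - 1)"
  using letter_pos_spec[of i "phased_path n k" North] assms count_phased_path[OF assms(1,2)]
  by (auto simp: shuffle_def Let_def)


subsection \<open>Tableaux\<close>

text \<open>Squares are pairs (row, column), both counted from 1, in English notation.\<close>

definition diagram :: "int list \<Rightarrow> (nat \<times> nat) set" where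
  "diagram \<kappa> = {(r, c). 1 \<le> r \<and> r \<le> length \<kappa> \<and> 1 \<le> c \<and> int c \<le> \<kappa> ! (r - 1)}"

definition ssyt :: "int list \<Rightarrow> (nat \<times> nat \<Rightarrow> nat) \<Rightarrow> bool" where
  "ssyt \<kappa> T \<longleftrightarrow>
     T \<in> extensional (diagram \<kappa>) \<and>
     (\<forall>s\<in>diagram \<kappa>. 1 \<le> T s) \<and>
     (\<forall>r c c'. (r, c) \<in> diagram \<kappa> \<longrightarrow> (r, c') \<in> diagram \<kappa> \<longrightarrow> c \<le> c' \<longrightarrow> T (r, c) \<le> T (r, c')) \<and>
     (\<forall>r r' c. (r, c) \<in> diagram \<kappa> \<longrightarrow> (r', c) \<in> diagram \<kappa> \<longrightarrow> r < r' \<longrightarrow> T (r, c) < T (r', c))"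

definition has_content :: "int list \<Rightarrow> (nat \<times> nat \<Rightarrow> nat) \<Rightarrow> int list \<Rightarrow> bool" where
  "has_content \<kappa> T \<gamma> \<longleftrightarrow>
     (\<forall>v\<ge>1. int (card {s \<in> diagram \<kappa>. T s = v}) = (if v \<le> length \<gamma> then \<gamma> ! (v - 1) else 0))"

definition northeast :: "nat \<times> nat \<Rightarrow> nat \<times> nat \<Rightarrow> bool" where
  "northeast s t \<longleftrightarrow> fst s \<le> fst t \<and> snd s \<ge> snd t"

definition common_columns :: "int list \<Rightarrow> int list \<Rightarrow> nat \<Rightarrow> nat" where
  "common_columns \<alpha> \<beta> i =
     card ({\<beta> ! (i - 1) <.. \<alpha> ! (i - 1)} \<inter> {\<beta> ! i <.. \<alpha> ! i})"

definition has_ne_pairs ::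
  "int list \<Rightarrow> (nat \<times> nat \<Rightarrow> nat) \<Rightarrow> nat \<Rightarrow> nat \<Rightarrow> nat \<Rightarrow> bool" where
  "has_ne_pairs \<kappa> T a p q \<longleftrightarrow>
     (\<exists>M. M \<subseteq> diagram \<kappa> \<times> diagram \<kappa> \<and> a \<le> card M \<and>
          (\<forall>(s, t)\<in>M. T s = p \<and> T t = q \<and> northeast s t) \<and>
          pairwise (\<lambda>(s, t) (s', t'). disjnt {s, t} {s', t'}) M)"

definition peelable_tableaux ::
  "nat \<Rightarrow> int \<Rightarrow> int list \<Rightarrow> int list \<Rightarrow> int list \<Rightarrow> int list \<Rightarrow> int list \<Rightarrow> (nat \<times> nat \<Rightarrow> nat) set" where
  "peelable_tableaux n k lam \<mu> \<nu> \<rho> \<kappa> =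
     {T. ssyt \<kappa> T \<and>
         has_content \<kappa> T (shuffle n k (map2 (-) lam \<mu>) (map2 (-) \<nu> \<rho>)) \<and>
         (\<forall>i. 1 \<le> i \<and> i < n \<longrightarrow>
            has_ne_pairs \<kappa> T (common_columns lam \<mu> i)
              (letter_pos (phased_path n k) West i) (letter_pos (phased_path n k) West (i + 1)) \<and>
            has_ne_pairs \<kappa> T (common_columns \<nu> \<rho> i)
              (letter_pos (phased_path n k) North i) (letter_pos (phased_path n k) North (i + 1)))}"


subsection \<open>Phased skew hives\<close>

definition Delta :: "nat \<Rightarrow> (nat \<times> nat) set" where
  "Delta m = {(i, j). i + j \<le> m}"

text \<open>The three signs are chosen independently.\<close>

definition unit_triangle :: "(int \<times> int \<times> int) set \<Rightarrow> bool" where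
  "unit_triangle t \<longleftrightarrow>
     (\<exists>w. \<exists>s1\<in>{1, -1}. \<exists>s2\<in>{1, -1}. \<exists>s3\<in>{1, -1}.
        t = {w + (s1, 0, 0), w + (0, s2, 0), w + (0, 0, s3)})"

definition real_point :: "int \<times> int \<times> int \<Rightarrow> real \<times> real \<times> real" where
  "real_point = (\<lambda>(a, b, c). (of_int a, of_int b, of_int c))"

text \<open>The long diagonal is \<open>{x, y}\<close>, the short diagonal (shared edge) is \<open>{x', y'}\<close>.\<close>

definition unit_rhombus ::
  "int \<times> int \<times> int \<Rightarrow> int \<times> int \<times> int \<Rightarrow> int \<times> int \<times> int \<Rightarrow> int \<times> int \<times> int \<Rightarrow> bool" where
  "unit_rhombus x y x' y' \<longleftrightarrow>
     unit_triangle {x, x', y'} \<and> unit_triangle {y, x', y'} \<and> x \<noteq> y \<and>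
     coplanar (real_point ` {x, y, x', y'})"

definition lift_point :: "nat \<Rightarrow> int \<Rightarrow> nat \<times> nat \<Rightarrow> int \<times> int \<times> int" where
  "lift_point n k = (\<lambda>(i, j). (int i, int j, ht (phased_path n k) (2 * n - i - j)))"

definition phased_hive :: "nat \<Rightarrow> int \<Rightarrow> (nat \<times> nat \<Rightarrow> int) \<Rightarrow> bool" where
  "phased_hive n k h \<longleftrightarrow>
     h \<in> extensional (Delta (2 * n)) \<and>
     (\<forall>x\<in>Delta (2 * n). \<forall>y\<in>Delta (2 * n). \<forall>x'\<in>Delta (2 * n). \<forall>y'\<in>Delta (2 * n).
        unit_rhombus (lift_point n k x) (lift_point n k y) (lift_point n k x') (lift_point n k y')
        \<longrightarrow> h x' + h y' \<ge> h x + h y)"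

definition edge_up :: "nat \<Rightarrow> (nat \<times> nat \<Rightarrow> int) \<Rightarrow> int list" where
  "edge_up m h = map (\<lambda>j. h (0, j + 1) - h (0, j)) [0..<m]"

definition edge_right :: "nat \<Rightarrow> (nat \<times> nat \<Rightarrow> int) \<Rightarrow> int list" where
  "edge_right m h = map (\<lambda>i. h (i + 1, 0) - h (i, 0)) [0..<m]"

definition edge_nw :: "nat \<Rightarrow> (nat \<times> nat \<Rightarrow> int) \<Rightarrow> int list" where
  "edge_nw m h = map (\<lambda>j. h (m - (j + 1), j + 1) - h (m - j, j)) [0..<m]"

definition skew_hives ::
  "nat \<Rightarrow> int \<Rightarrow> int list \<Rightarrow> int list \<Rightarrow> int list \<Rightarrow> int list \<Rightarrow> int list \<Rightarrow> (nat \<times> nat \<Rightarrow> int) set" where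
  "skew_hives n k lam \<mu> \<nu> \<rho> \<kappa> =
     {h. phased_hive n k h \<and> h (0, 0) = 0 \<and>
         edge_up (2 * n) h = shuffle n k lam \<nu> \<and>
         edge_right (2 * n) h = shuffle n k \<mu> \<rho> \<and>
         edge_nw (2 * n) h = \<kappa>}"


subsection \<open>The hive of a tableau\<close>

text \<open>Length of row \<open>a\<close> of the subtableau formed by the entries at most \<open>i\<close>.\<close>

definition sub_shape :: "int list \<Rightarrow> (nat \<times> nat \<Rightarrow> nat) \<Rightarrow> nat \<Rightarrow> nat \<Rightarrow> int" where
  "sub_shape \<kappa> T i a = int (card {c. (a, c) \<in> diagram \<kappa> \<and> T (a, c) \<le> i})"

definition y_entry ::
  "nat \<Rightarrow> int \<Rightarrow> int list \<Rightarrow> int list \<Rightarrow> int list \<Rightarrow> (nat \<times> nat \<Rightarrow> nat) \<Rightarrow> nat \<Rightarrow> nat \<Rightarrow> int" where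
  "y_entry n k \<mu> \<rho> \<kappa> T i j =
     (\<Sum>a = 1..j. sub_shape \<kappa> T i a) + (\<Sum>a = 1..i. shuffle n k \<mu> \<rho> ! (a - 1))"

definition tableau_hive ::
  "nat \<Rightarrow> int \<Rightarrow> int list \<Rightarrow> int list \<Rightarrow> int list \<Rightarrow> (nat \<times> nat \<Rightarrow> nat) \<Rightarrow> (nat \<times> nat \<Rightarrow> int)" where
  "tableau_hive n k \<mu> \<rho> \<kappa> T =
     restrict (\<lambda>(i, j). y_entry n k \<mu> \<rho> \<kappa> T (i + j) j) (Delta (2 * n))"

end

theory Submission
  imports Defs
begin

text \<open>
  Write \<open>x m a\<close> for the length of row \<open>a\<close> of the subtableau formed by the entries at most \<open>m\<close>, and
  \<open>cells v j\<close> for the number of entries \<open>v\<close> in the first \<open>j\<close> rows. A semistandard tableau of shape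
  \<open>\<kappa>\<close> is the same thing as a Gelfand-Tsetlin pattern \<open>x\<close> with last row \<open>\<kappa>\<close>, and the hive of a tableau
  records the partial sums of the rows of its pattern, shifted by a function of the level \<open>i + j\<close>
  alone. So everything reduces to reading the rhombus inequalities off the pattern.

  A rhombus in the lifted triangle is a parallelogram (\<open>unit_rhombus_parallelogram\<close>), which leaves
  three kinds of inequality (\<open>phased_hive_iff\<close>). Two of the three orientations are flat at every
  level, and their inequalities say that \<open>x\<close> interlaces, which holds for every tableau. The third
  orientation, across a level \<open>m\<close>, is flat exactly when letters \<open>m\<close> and \<open>m + 1\<close> of the path agree.
  Where three successive letters alternate, the surface folds along the diagonals, and longer rhombi
  spanning four levels appear. Hence the remaining inequalities live on pairs of levels \<open>p < q\<close> with
  \<open>q \<le> p + 2\<close> carrying two consecutive occurrences of one letter (\<open>linked_iff\<close>). Written in terms of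
  the tableau they are
  \<open>cells q (j + 1) \<le> cells p j + d\<close> and
  \<open>cells q (j + 1) + x q (j + 2) \<le> cells p j + x p (j + 1) + d\<close>, where \<open>d\<close> is the difference of
  the two consecutive parts of the inner partition (\<open>phased_hive_h_iff\<close>).

  These are precisely the Hall conditions for matching the entries \<open>p\<close> and \<open>q\<close> into disjoint
  northeast pairs so that at most \<open>d\<close> entries \<open>q\<close> stay unmatched. They are necessary because the
  entries \<open>q\<close> of the first \<open>j + 1\<close> rows, together with those of row \<open>j + 2\<close> lying to the right of
  every entry \<open>p\<close> in row \<open>j + 1\<close>, can only be matched with entries \<open>p\<close> of the first \<open>j\<close> rows
  (\<open>ineqs_of_ne_pairs\<close>). They are sufficient because one explicit matching works: number the
  entries \<open>p\<close> and the entries \<open>q\<close> in reading order, and pair the \<open>l\<close>-th \<open>p\<close> with the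
  \<open>(l + d)\<close>-th \<open>q\<close>; the first inequality puts the rows, the second the columns, in the right
  position (\<open>ne_pairs_of_ineqs\<close>). The number of pairs that a peelable tableau must have differs
  from this one only in cases where both conditions hold trivially (\<open>ne_pairs_iff\<close>).

  Finally the hive determines the pattern and so the tableau, and the interlacing inequalities of an
  arbitrary hive make its pattern that of a tableau (\<open>hive_has_tableau\<close>).
\<close>

section \<open>Unit rhombi\<close>

definition sqdist :: "int \<times> int \<times> int \<Rightarrow> int \<times> int \<times> int \<Rightarrow> int" where
  "sqdist = (\<lambda>(a, b, c) (a', b', c'). (a - a')\<^sup>2 + (b - b')\<^sup>2 + (c - c')\<^sup>2)"

lemma unit_triangle_sqdist:
  assumes "unit_triangle {x, y, z}"
  shows "sqdist x y = 2" "sqdist x z = 2" "sqdist y z = 2"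
proof -
  obtain w s1 s2 s3 where s: "s1 \<in> {1, -1}" "s2 \<in> {1, -1}" "s3 \<in> {1, -1 :: int}"
    and t: "{x, y, z} = {w + (s1, 0, 0), w + (0, s2, 0), w + (0, 0, s3)}" (is "_ = ?t")
    using assms unfolding unit_triangle_def by blast
  have "card ?t = 3"
    using s by (auto simp: card_insert_if)
  then have "card {x, y, z} = 3"
    by (simp add: t)
  then have ne: "x \<noteq> y" "x \<noteq> z" "y \<noteq> z"
    by (auto simp: card_insert_if split: if_splits)
  have d: "sqdist p q = 2" if "p \<in> ?t" "q \<in> ?t" "p \<noteq> q" for p q
    using that s by (cases w) (auto simp: sqdist_def)
  show "sqdist x y = 2" "sqdist x z = 2" "sqdist y z = 2"
    using ne by (intro d; simp flip: t)+
qed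

text \<open>
  Coplanarity enters only through a common normal vector: differences of coplanar points span at most
  a plane, and a proper subspace has a nonzero orthogonal vector.
\<close>

lemma coplanar_normal:
  fixes S :: "(real \<times> real \<times> real) set"
  assumes "coplanar S"
  obtains n where "n \<noteq> 0" "\<And>p q. p \<in> S \<Longrightarrow> q \<in> S \<Longrightarrow> n \<bullet> (p - q) = 0"
proof -
  obtain u v w where S: "S \<subseteq> affine hull {u, v, w}"
    using assms by (auto simp: coplanar_def)
  have "dim {v - u, w - u} \<le> card {v - u, w - u}"
    by (rule dim_le_card') simp
  also have "\<dots> < DIM(real \<times> real \<times> real)"
    by (auto simp: card_insert_if)
  finally have "dim {v - u, w - u} < DIM(real \<times> real \<times> real)" .
  from orthogonal_to_subspace_exists[OF this]
  obtain n where n: "n \<noteq> 0" "\<And>y. y \<in> span {v - u, w - u} \<Longrightarrow> orthogonal n y"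
    by metis
  have *: "n \<bullet> p = n \<bullet> u" if "p \<in> S" for p
  proof -
    obtain a b c where abc: "p = a *\<^sub>R u + b *\<^sub>R v + c *\<^sub>R w" "a + b + c = 1"
      using S \<open>p \<in> S\<close> by (auto simp: affine_hull_3)
    have "n \<bullet> (v - u) = 0" "n \<bullet> (w - u) = 0"
      using n(2) span_base[of _ "{v - u, w - u}"] by (auto simp: orthogonal_def)
    then have "n \<bullet> v = n \<bullet> u" "n \<bullet> w = n \<bullet> u"
      by (auto simp: inner_diff_right)
    then have "n \<bullet> p = (a + b + c) * (n \<bullet> u)"
      by (simp add: abc(1) inner_add_right algebra_simps)
    then show ?thesis
      by (simp add: abc(2))
  qed
  show ?thesis
    by (rule that[of n]) (use n(1) * in \<open>auto simp: inner_diff_right\<close>)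
qed

text \<open>
  The Gram determinant of three vectors is the square of their determinant.
\<close>

lemma det3_gram:
  fixes e1 e2 e3 u1 u2 u3 v1 v2 v3 :: int
  shows "(e1 * (u2 * v3 - u3 * v2) - e2 * (u1 * v3 - u3 * v1) + e3 * (u1 * v2 - u2 * v1))\<^sup>2
    = (e1\<^sup>2 + e2\<^sup>2 + e3\<^sup>2) * (u1\<^sup>2 + u2\<^sup>2 + u3\<^sup>2) * (v1\<^sup>2 + v2\<^sup>2 + v3\<^sup>2)
      + 2 * (e1 * u1 + e2 * u2 + e3 * u3) * (u1 * v1 + u2 * v2 + u3 * v3) * (e1 * v1 + e2 * v2 + e3 * v3)
      - (e1\<^sup>2 + e2\<^sup>2 + e3\<^sup>2) * (u1 * v1 + u2 * v2 + u3 * v3)\<^sup>2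
      - (u1\<^sup>2 + u2\<^sup>2 + u3\<^sup>2) * (e1 * v1 + e2 * v2 + e3 * v3)\<^sup>2
      - (v1\<^sup>2 + v2\<^sup>2 + v3\<^sup>2) * (e1 * u1 + e2 * u2 + e3 * u3)\<^sup>2"
  by (simp add: power2_eq_square algebra_simps)

lemma det3_zero:
  fixes n1 n2 n3 :: real and e1 e2 e3 u1 u2 u3 v1 v2 v3 :: int
  assumes "n1 \<noteq> 0 \<or> n2 \<noteq> 0 \<or> n3 \<noteq> 0"
    and "n1 * e1 + n2 * e2 + n3 * e3 = 0" "n1 * u1 + n2 * u2 + n3 * u3 = 0"
      "n1 * v1 + n2 * v2 + n3 * v3 = 0"
  shows "e1 * (u2 * v3 - u3 * v2) - e2 * (u1 * v3 - u3 * v1) + e3 * (u1 * v2 - u2 * v1) = 0" (is "?D = 0")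
proof -
  have "n1 * real_of_int ?D = 0" "n2 * real_of_int ?D = 0" "n3 * real_of_int ?D = 0"
    unfolding of_int_add of_int_diff of_int_mult using assms(2-4) by algebra+
  then have "real_of_int ?D = 0"
    using assms(1) by (metis mult_eq_0_iff)
  then show ?thesis
    by (simp only: of_int_eq_0_iff)
qed

text \<open>
  Put \<open>e = y' - x'\<close>, \<open>u = x - x'\<close>, \<open>v = y - x'\<close>. Both triangles are equilateral with side
  \<open>sqrt 2\<close>, which fixes all inner products of these vectors except \<open>t = u \<bullet> v\<close>. Coplanarity makes
  the Gram determinant vanish, which gives \<open>(t - 2) (t + 1) = 0\<close>. The root \<open>2\<close> is the degenerate
  case \<open>x = y\<close>, and the root \<open>- 1\<close> means \<open>u + v = e\<close>.
\<close>

lemma unit_rhombus_parallelogram: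
  assumes "unit_rhombus x y x' y'"
  shows "x + y = x' + y'"
proof -
  obtain x1 x2 x3 y1 y2 y3 a1 a2 a3 b1 b2 b3 where
    x: "x = (x1, x2, x3)" and y: "y = (y1, y2, y3)" and
    x': "x' = (a1, a2, a3)" and y': "y' = (b1, b2, b3)"
    by (metis prod_cases3)
  define e1 e2 e3 u1 u2 u3 v1 v2 v3 where defs: "e1 = b1 - a1" "e2 = b2 - a2" "e3 = b3 - a3"
    "u1 = x1 - a1" "u2 = x2 - a2" "u3 = x3 - a3" "v1 = y1 - a1" "v2 = y2 - a2" "v3 = y3 - a3"
  have tri: "unit_triangle {x, x', y'}" "unit_triangle {y, x', y'}" and ne: "x \<noteq> y"
    and cop: "coplanar (real_point ` {x, y, x', y'})"
    using assms by (auto simp: unit_rhombus_def)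
  have E: "e1\<^sup>2 + e2\<^sup>2 + e3\<^sup>2 = 2" and U: "u1\<^sup>2 + u2\<^sup>2 + u3\<^sup>2 = 2" and V: "v1\<^sup>2 + v2\<^sup>2 + v3\<^sup>2 = 2"
    and EU: "(u1 - e1)\<^sup>2 + (u2 - e2)\<^sup>2 + (u3 - e3)\<^sup>2 = 2"
    and EV: "(v1 - e1)\<^sup>2 + (v2 - e2)\<^sup>2 + (v3 - e3)\<^sup>2 = 2"
    using unit_triangle_sqdist[OF tri(1)] unit_triangle_sqdist[OF tri(2)]
    by (auto simp: sqdist_def x y x' y' defs power2_commute)
  have eu: "e1 * u1 + e2 * u2 + e3 * u3 = 1" using E U EU
    by (simp add: power2_eq_square algebra_simps)
  have ev: "e1 * v1 + e2 * v2 + e3 * v3 = 1" using E V EV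
    by (simp add: power2_eq_square algebra_simps)
  obtain n where "n \<noteq> 0" and
    n: "\<And>p q. p \<in> real_point ` {x, y, x', y'} \<Longrightarrow> q \<in> real_point ` {x, y, x', y'} \<Longrightarrow> n \<bullet> (p - q) = 0"
    using coplanar_normal[OF cop] by blast
  obtain n1 n2 n3 where n123: "n = (n1, n2, n3)"
    by (metis prod_cases3)
  have "n1 \<noteq> 0 \<or> n2 \<noteq> 0 \<or> n3 \<noteq> 0"
    using \<open>n \<noteq> 0\<close> by (auto simp: n123 zero_prod_def)
  moreover have "n1 * e1 + n2 * e2 + n3 * e3 = 0" "n1 * u1 + n2 * u2 + n3 * u3 = 0"
      "n1 * v1 + n2 * v2 + n3 * v3 = 0"
    using n[of "real_point y'" "real_point x'"] n[of "real_point x" "real_point x'"]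
      n[of "real_point y" "real_point x'"]
    by (auto simp: n123 real_point_def x y x' y' defs)
  ultimately have D: "e1 * (u2 * v3 - u3 * v2) - e2 * (u1 * v3 - u3 * v1) + e3 * (u1 * v2 - u2 * v1) = 0"
    by (rule det3_zero)
  define t where "t = u1 * v1 + u2 * v2 + u3 * v3"
  have "(t - 2) * (t + 1) = 0"
    using det3_gram[of e1 u2 v3 u3 v2 e2 u1 v1 e3] unfolding D E U V eu ev t_def[symmetric]
    by (simp add: algebra_simps power2_eq_square)
  moreover have "t \<noteq> 2"
  proof
    assume "t = 2"
    then have "(u1 - v1)\<^sup>2 + (u2 - v2)\<^sup>2 + (u3 - v3)\<^sup>2 = 0"
      using U V by (simp add: t_def power2_eq_square algebra_simps)
    then have "u1 = v1 \<and> u2 = v2 \<and> u3 = v3"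
      by (smt (verit) zero_eq_power2 zero_le_power2)
    then show False
      using ne by (simp add: x y defs)
  qed
  ultimately have t: "t = - 1"
    by auto
  have "(u1 + v1 - e1)\<^sup>2 + (u2 + v2 - e2)\<^sup>2 + (u3 + v3 - e3)\<^sup>2 = 0"
    using U V E eu ev t by (simp add: t_def power2_eq_square algebra_simps)
  then have "u1 + v1 = e1 \<and> u2 + v2 = e2 \<and> u3 + v3 = e3"
    by (smt (verit) zero_eq_power2 zero_le_power2)
  then show ?thesis
    by (simp add: x y x' y' defs)
qed

lemma unit_rhombusI:
  assumes "unit_triangle {x, x', y'}" "unit_triangle {y, x', y'}" "x + y = x' + y'" "x \<noteq> y"
  shows "unit_rhombus x y x' y'"
proof -
  have "real_point x + real_point y = real_point x' + real_point y'"
    using assms(3) by (cases x; cases y; cases x'; cases y')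
      (auto simp: real_point_def simp flip: of_int_add)
  then have "real_point y = (-1) *\<^sub>R real_point x + 1 *\<^sub>R real_point x' + 1 *\<^sub>R real_point y'"
    by (simp add: algebra_simps)
  then have "real_point y \<in> affine hull {real_point x, real_point x', real_point y'}"
    unfolding affine_hull_3 by (intro CollectI exI[of _ "-1::real"] exI[of _ "1::real"]) auto
  then have "real_point ` {x, y, x', y'} \<subseteq> affine hull {real_point x, real_point x', real_point y'}"
    by (auto simp: hull_inc)
  then show ?thesis
    using assms unfolding unit_rhombus_def coplanar_def by blast
qed

lemma unit_triangleI:
  assumes "t = {(a + s1, b, c), (a, b + s2, c), (a, b, c + s3)}"
    "s1 \<in> {1, -1}" "s2 \<in> {1, -1}" "s3 \<in> {1, -1}"
  shows "unit_triangle t"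
  unfolding unit_triangle_def
  by (rule exI[of _ "(a, b, c)"], rule bexI[OF _ assms(2)], rule bexI[OF _ assms(3)],
      rule bexI[OF _ assms(4)]) (simp add: assms(1))

section \<open>The inequalities of a lifted hive\<close>

lemma sum_three_squares_eq_2:
  fixes a b c :: int
  assumes "a\<^sup>2 + b\<^sup>2 + c\<^sup>2 = 2"
  shows "a \<in> {-1, 0, 1}" "b \<in> {-1, 0, 1}" "c \<in> {-1, 0, 1}"
proof -
  have *: "x \<in> {-1, 0, 1}" if "x\<^sup>2 \<le> 2" for x :: int
  proof -
    have "\<bar>x\<bar> < 2"
    proof (rule ccontr)
      assume "\<not> \<bar>x\<bar> < 2"
      then have "2\<^sup>2 \<le> \<bar>x\<bar>\<^sup>2"
        by (intro power_mono) auto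
      with that show False by simp
    qed
    then show ?thesis by auto
  qed
  have "0 \<le> a\<^sup>2" "0 \<le> b\<^sup>2" "0 \<le> c\<^sup>2" by auto
  then show "a \<in> {-1, 0, 1}" "b \<in> {-1, 0, 1}" "c \<in> {-1, 0, 1}"
    using assms by (intro *; linarith)+
qed

definition lift :: "(nat \<Rightarrow> int) \<Rightarrow> nat \<times> nat \<Rightarrow> int \<times> int \<times> int" where
  "lift H = (\<lambda>(i, j). (int i, int j, H (i + j)))"

definition lifted_hive_ineqs :: "nat \<Rightarrow> (nat \<Rightarrow> int) \<Rightarrow> (nat \<times> nat \<Rightarrow> int) \<Rightarrow> bool" where
  "lifted_hive_ineqs N H h \<longleftrightarrow>
    (\<forall>i j. i + j + 2 \<le> N \<longrightarrow>
       h (i, j + 2) + h (i + 1, j) \<le> h (i, j + 1) + h (i + 1, j + 1) \<and>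
       h (i + 2, j) + h (i, j + 1) \<le> h (i + 1, j) + h (i + 1, j + 1) \<and>
       (H (i + j + 2) \<noteq> H (i + j) \<longrightarrow> h (i, j) + h (i + 1, j + 1) \<le> h (i, j + 1) + h (i + 1, j))) \<and>
    (\<forall>i j. i + j + 3 \<le> N \<longrightarrow> H (i + j + 2) = H (i + j) \<longrightarrow> H (i + j + 3) = H (i + j + 1) \<longrightarrow>
       h (i, j) + h (i + 1, j + 2) \<le> h (i, j + 1) + h (i + 1, j + 1) \<and>
       h (i, j) + h (i + 2, j + 1) \<le> h (i + 1, j) + h (i + 1, j + 1))"

lemma unit_rhombus_swap:
  "unit_rhombus x y x' y' \<longleftrightarrow> unit_rhombus y x x' y'"
  "unit_rhombus x y x' y' \<longleftrightarrow> unit_rhombus x y y' x'"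
  by (auto simp: unit_rhombus_def insert_commute)

context
  fixes N :: nat and H :: "nat \<Rightarrow> int"
  assumes step: "\<And>m. m < N \<Longrightarrow> \<bar>H (Suc m) - H m\<bar> = 1"
begin

text \<open>
  By the parallelogram law a rhombus is determined by the edge \<open>b - a\<close> of length \<open>sqrt 2\<close> and the
  vector \<open>x - a\<close>, so there are finitely many candidates. The ordering assumptions select one
  representative under the symmetries that exchange \<open>a\<close> with \<open>b\<close> and \<open>x\<close> with \<open>y\<close>. Each candidate
  survives exactly when the height of its fourth vertex is the height prescribed by its level. In
  particular a short diagonal from \<open>(i, j)\<close> to \<open>(i + 1, j + 1)\<close> never survives, since both vertices
  of the long diagonal would lie at the same height on the level in between.
\<close>

lemma lifted_rhombus_ordered:
  assumes rh: "unit_rhombus (lift H x) (lift H y) (lift H a) (lift H b)"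
    and mem: "x \<in> Delta N" "y \<in> Delta N" "a \<in> Delta N" "b \<in> Delta N"
    and before: "fst a + snd a < fst b + snd b \<or> fst a + snd a = fst b + snd b \<and> fst a < fst b"
    and low: "fst x + snd x \<le> fst y + snd y"
  shows "\<exists>i j.
    i + j + 2 \<le> N \<and> x = (i + 1, j) \<and> y = (i, j + 2) \<and> a = (i, j + 1) \<and> b = (i + 1, j + 1) \<or>
    i + j + 2 \<le> N \<and> x = (i, j + 1) \<and> y = (i + 2, j) \<and> a = (i + 1, j) \<and> b = (i + 1, j + 1) \<or>
    i + j + 2 \<le> N \<and> H (i + j + 2) \<noteq> H (i + j) \<and>
      x = (i, j) \<and> y = (i + 1, j + 1) \<and> a = (i, j + 1) \<and> b = (i + 1, j) \<or>
    i + j + 3 \<le> N \<and> H (i + j + 2) = H (i + j) \<and> H (i + j + 3) = H (i + j + 1) \<and>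
      (x = (i, j) \<and> y = (i + 1, j + 2) \<and> a = (i, j + 1) \<and> b = (i + 1, j + 1) \<or>
       x = (i, j) \<and> y = (i + 2, j + 1) \<and> a = (i + 1, j) \<and> b = (i + 1, j + 1))"
    (is "\<exists>i j. ?R i j")
proof -
  obtain x1 x2 y1 y2 a1 a2 b1 b2 where xyab: "x = (x1, x2)" "y = (y1, y2)" "a = (a1, a2)" "b = (b1, b2)"
    by (metis surj_pair)
  note rh = rh[unfolded xyab]
  have N: "x1 + x2 \<le> N" "y1 + y2 \<le> N" "a1 + a2 \<le> N" "b1 + b2 \<le> N"
    and ord: "a1 + a2 < b1 + b2 \<or> a1 + a2 = b1 + b2 \<and> a1 < b1" "x1 + x2 \<le> y1 + y2"
    using mem before low by (auto simp: xyab Delta_def)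
  define e1 e2 e3 u1 u2 u3 where defs: "e1 = int b1 - int a1" "e2 = int b2 - int a2"
    "e3 = H (b1 + b2) - H (a1 + a2)" "u1 = int x1 - int a1" "u2 = int x2 - int a2"
    "u3 = H (x1 + x2) - H (a1 + a2)"
  have par: "int x1 + int y1 = int a1 + int b1" "int x2 + int y2 = int a2 + int b2"
    "H (x1 + x2) + H (y1 + y2) = H (a1 + a2) + H (b1 + b2)"
    using unit_rhombus_parallelogram[OF rh] by (auto simp: lift_def)
  have "unit_triangle {lift H (x1, x2), lift H (a1, a2), lift H (b1, b2)}"
    using rh by (simp add: unit_rhombus_def)
  note sq = unit_triangle_sqdist[OF this]
  have E: "e1\<^sup>2 + e2\<^sup>2 + e3\<^sup>2 = 2" and U: "u1\<^sup>2 + u2\<^sup>2 + u3\<^sup>2 = 2"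
    and EU: "(u1 - e1)\<^sup>2 + (u2 - e2)\<^sup>2 + (u3 - e3)\<^sup>2 = 2"
    using sq by (auto simp: sqdist_def lift_def defs power2_commute)
  have eu: "e1 * u1 + e2 * u2 + e3 * u3 = 1"
    using E U EU by (simp add: power2_eq_square algebra_simps)
  have ord': "e1 + e2 > 0 \<or> e1 + e2 = 0 \<and> e1 > 0" "2 * (u1 + u2) \<le> e1 + e2"
    using ord par by (auto simp: defs)
  note er = sum_three_squares_eq_2[OF E] and ur = sum_three_squares_eq_2[OF U]
  have "(e1, e2, e3) \<in> {(1, -1, 0), (1, 0, 1), (1, 0, -1), (0, 1, 1), (0, 1, -1), (1, 1, 0)}"
    using er E ord'(1) unfolding insert_iff empty_iff simp_thms by (elim disjE; simp)
  then consider "e1 = 1" "e2 = -1" "e3 = 0" | "e1 = 1" "e2 = 0" "e3 = 1 \<or> e3 = -1"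
    | "e1 = 0" "e2 = 1" "e3 = 1 \<or> e3 = -1" | "e1 = 1" "e2 = 1" "e3 = 0"
    by force
  then show ?thesis
  proof cases
    case 1
    then have "u1 = 0" "u2 = -1"
      using ur(1,2) eu ord'(2) by auto
    then have eq: "a1 = x1" "a2 = x2 + 1" "b1 = x1 + 1" "b2 = x2" "y1 = x1 + 1" "y2 = x2 + 1"
      using 1 par(1,2) by (auto simp: defs)
    \<comment> \<open>Opposite vertices lie one step up and one step down from the level of the diagonal.\<close>
    have "H (x1 + x2 + 2) \<noteq> H (x1 + x2)"
      using par(3) step[of "x1 + x2"] N by (auto simp: eq)
    then have "?R x1 x2"
      using N by (auto simp: eq xyab)
    then show ?thesis by blast
  next
    case 2
    then have "u1 = 1 \<and> u2 = -1 \<and> u3 = 0 \<or> u1 = 0 \<and> u2 = -1 \<and> u3 = e3"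
      using ur eu ord'(2) U by (elim insertE disjE; simp)
    then show ?thesis
    proof (elim disjE conjE)
      assume "u1 = 1" "u2 = -1"
      then have eq: "a1 = y1" "a2 = x2 + 1" "b1 = y1 + 1" "b2 = x2 + 1" "x1 = y1 + 1" "y2 = x2 + 2"
        using 2 par(1,2) by (auto simp: defs)
      then have "?R y1 x2"
        using N by (auto simp: eq xyab)
      then show ?thesis by blast
    next
      assume u: "u1 = 0" "u2 = -1" "u3 = e3"
      then have eq: "a1 = x1" "a2 = x2 + 1" "b1 = x1 + 1" "b2 = x2 + 1" "y1 = x1 + 1" "y2 = x2 + 2"
        using 2 par(1,2) by (auto simp: defs)
      have H: "H (x1 + x2 + 2) = H (x1 + x2)"
        using u by (auto simp: defs eq)
      moreover have "H (x1 + x2 + 3) = H (x1 + x2 + 1)"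
        using par(3) H by (auto simp: eq numeral_eq_Suc)
      ultimately have "?R x1 x2"
        using N by (auto simp: eq xyab)
      then show ?thesis by blast
    qed
  next
    case 3
    then have "u1 = -1 \<and> u2 = 1 \<and> u3 = 0 \<or> u1 = -1 \<and> u2 = 0 \<and> u3 = e3"
      using ur eu ord'(2) U by (elim insertE disjE; simp)
    then show ?thesis
    proof (elim disjE conjE)
      assume "u1 = -1" "u2 = 1"
      then have eq: "a1 = x1 + 1" "x2 = y2 + 1" "b1 = x1 + 1" "a2 = y2" "b2 = y2 + 1" "y1 = x1 + 2"
        using 3 par(1,2) by (auto simp: defs)
      then have "?R x1 y2"
        using N by (auto simp: eq xyab)
      then show ?thesis by blast
    next
      assume u: "u1 = -1" "u2 = 0" "u3 = e3"
      then have eq: "a1 = x1 + 1" "a2 = x2" "b1 = x1 + 1" "b2 = x2 + 1" "y1 = x1 + 2" "y2 = x2 + 1"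
        using 3 par(1,2) by (auto simp: defs)
      have H: "H (x1 + x2 + 2) = H (x1 + x2)"
        using u by (auto simp: defs eq)
      moreover have "H (x1 + x2 + 3) = H (x1 + x2 + 1)"
        using par(3) H by (auto simp: eq numeral_eq_Suc)
      ultimately have "?R x1 x2"
        using N by (auto simp: eq xyab)
      then show ?thesis by blast
    qed
  next
    case 4
    then have "x1 + x2 = Suc (a1 + a2)" "y1 + y2 = Suc (a1 + a2)" "H (b1 + b2) = H (a1 + a2)"
      using eu par(1,2) by (auto simp: defs)
    then show ?thesis
      using par(3) step[of "a1 + a2"] N by auto
  qed
qed

lemma step_signs: "m < N \<Longrightarrow> H (Suc m) - H m \<in> {1, -1}" "m < N \<Longrightarrow> H m - H (Suc m) \<in> {1, -1}"
  using step[of m] by auto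

lemma lifted_triangles:
  shows "i + j + 1 \<le> N \<Longrightarrow> unit_triangle {lift H (i, j), lift H (i, j + 1), lift H (i + 1, j)}"
    and "i + j + 2 \<le> N \<Longrightarrow> unit_triangle {lift H (i + 1, j + 1), lift H (i, j + 1), lift H (i + 1, j)}"
    and "i + j + 2 \<le> N \<Longrightarrow> H (i + j + 2) = H (i + j) \<Longrightarrow>
      unit_triangle {lift H (i, j), lift H (i + 1, j), lift H (i + 1, j + 1)}"
    and "i + j + 2 \<le> N \<Longrightarrow> H (i + j + 2) = H (i + j) \<Longrightarrow>
      unit_triangle {lift H (i, j), lift H (i, j + 1), lift H (i + 1, j + 1)}"
proof -
  show "unit_triangle {lift H (i, j), lift H (i, j + 1), lift H (i + 1, j)}" if "i + j + 1 \<le> N"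
    by (rule unit_triangleI[of _ "int i" 1 "int j" "H (Suc (i + j))" 1 "H (i + j) - H (Suc (i + j))"])
      (use that step_signs[of "i + j"] in \<open>simp_all add: lift_def insert_commute add.commute\<close>)
  show "unit_triangle {lift H (i + 1, j + 1), lift H (i, j + 1), lift H (i + 1, j)}" if "i + j + 2 \<le> N"
    by (rule unit_triangleI[of _ "int i + 1" "-1" "int j + 1" "H (Suc (i + j))" "-1" "H (Suc (Suc (i + j))) - H (Suc (i + j))"])
      (use that step_signs[of "Suc (i + j)"] in \<open>simp_all add: lift_def insert_commute add.commute\<close>)
  show "unit_triangle {lift H (i, j), lift H (i + 1, j), lift H (i + 1, j + 1)}"
    if "i + j + 2 \<le> N" "H (i + j + 2) = H (i + j)"
    by (rule unit_triangleI[of _ "int i + 1" "-1" "int j" "H (i + j)" 1 "H (Suc (i + j)) - H (i + j)"])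
      (use that step_signs[of "i + j"] in \<open>simp_all add: lift_def insert_commute add.commute\<close>)
  show "unit_triangle {lift H (i, j), lift H (i, j + 1), lift H (i + 1, j + 1)}"
    if "i + j + 2 \<le> N" "H (i + j + 2) = H (i + j)"
    by (rule unit_triangleI[of _ "int i" 1 "int j + 1" "H (i + j)" "-1" "H (Suc (i + j)) - H (i + j)"])
      (use that step_signs[of "i + j"] in \<open>simp_all add: lift_def insert_commute add.commute\<close>)
qed

lemma lifted_rhombi:
  shows "i + j + 2 \<le> N \<Longrightarrow>
      unit_rhombus (lift H (i, j + 2)) (lift H (i + 1, j)) (lift H (i, j + 1)) (lift H (i + 1, j + 1))"
    and "i + j + 2 \<le> N \<Longrightarrow>
      unit_rhombus (lift H (i + 2, j)) (lift H (i, j + 1)) (lift H (i + 1, j)) (lift H (i + 1, j + 1))"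
    and "i + j + 2 \<le> N \<Longrightarrow> H (i + j + 2) \<noteq> H (i + j) \<Longrightarrow>
      unit_rhombus (lift H (i, j)) (lift H (i + 1, j + 1)) (lift H (i, j + 1)) (lift H (i + 1, j))"
    and "i + j + 3 \<le> N \<Longrightarrow> H (i + j + 2) = H (i + j) \<Longrightarrow> H (i + j + 3) = H (i + j + 1) \<Longrightarrow>
      unit_rhombus (lift H (i, j)) (lift H (i + 1, j + 2)) (lift H (i, j + 1)) (lift H (i + 1, j + 1))"
    and "i + j + 3 \<le> N \<Longrightarrow> H (i + j + 2) = H (i + j) \<Longrightarrow> H (i + j + 3) = H (i + j + 1) \<Longrightarrow>
      unit_rhombus (lift H (i, j)) (lift H (i + 2, j + 1)) (lift H (i + 1, j)) (lift H (i + 1, j + 1))"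
proof -
  show "unit_rhombus (lift H (i, j + 2)) (lift H (i + 1, j)) (lift H (i, j + 1)) (lift H (i + 1, j + 1))"
    if "i + j + 2 \<le> N"
    by (rule unit_rhombusI)
      (use that lifted_triangles(1)[of i "j + 1"] lifted_triangles(2)[of i j] in
        \<open>simp_all add: insert_commute\<close>, simp_all add: lift_def)
  show "unit_rhombus (lift H (i + 2, j)) (lift H (i, j + 1)) (lift H (i + 1, j)) (lift H (i + 1, j + 1))"
    if "i + j + 2 \<le> N"
    by (rule unit_rhombusI)
      (use that lifted_triangles(1)[of "i + 1" j] lifted_triangles(2)[of i j] in
        \<open>simp_all add: insert_commute\<close>, simp_all add: lift_def)
  show "unit_rhombus (lift H (i, j)) (lift H (i + 1, j + 1)) (lift H (i, j + 1)) (lift H (i + 1, j))"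
    if "i + j + 2 \<le> N" "H (i + j + 2) \<noteq> H (i + j)"
  proof -
    have "H (Suc (Suc (i + j))) + H (i + j) = 2 * H (Suc (i + j))"
      using that step_signs[of "i + j"] step_signs[of "Suc (i + j)"] by auto
    then show ?thesis
      by (intro unit_rhombusI)
        (use that lifted_triangles(1)[of i j] lifted_triangles(2)[of i j] in
          \<open>simp_all add: insert_commute\<close>, simp_all add: lift_def)
  qed
  show "unit_rhombus (lift H (i, j)) (lift H (i + 1, j + 2)) (lift H (i, j + 1)) (lift H (i + 1, j + 1))"
    if "i + j + 3 \<le> N" "H (i + j + 2) = H (i + j)" "H (i + j + 3) = H (i + j + 1)"
    by (rule unit_rhombusI)
      (use that lifted_triangles(4)[of i j] lifted_triangles(3)[of i "j + 1"] in
        \<open>simp_all add: insert_commute numeral_eq_Suc\<close>, simp_all add: lift_def)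
  show "unit_rhombus (lift H (i, j)) (lift H (i + 2, j + 1)) (lift H (i + 1, j)) (lift H (i + 1, j + 1))"
    if "i + j + 3 \<le> N" "H (i + j + 2) = H (i + j)" "H (i + j + 3) = H (i + j + 1)"
    by (rule unit_rhombusI)
      (use that lifted_triangles(3)[of i j] lifted_triangles(4)[of "i + 1" j] in
        \<open>simp_all add: insert_commute numeral_eq_Suc\<close>, simp_all add: lift_def)
qed

lemma lifted_hive_ineqs_iff:
  "(\<forall>x\<in>Delta N. \<forall>y\<in>Delta N. \<forall>x'\<in>Delta N. \<forall>y'\<in>Delta N.
      unit_rhombus (lift H x) (lift H y) (lift H x') (lift H y') \<longrightarrow> h x' + h y' \<ge> h x + h y)
    \<longleftrightarrow> lifted_hive_ineqs N H h" (is "?L \<longleftrightarrow> _")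
proof
  assume L: ?L
  note rh = lifted_rhombi
  have *: "h x + h y \<le> h x' + h y'"
    if "unit_rhombus (lift H x) (lift H y) (lift H x') (lift H y')"
      "{x, y, x', y'} \<subseteq> Delta N" for x y x' y'
    using L that by auto
  show "lifted_hive_ineqs N H h"
    unfolding lifted_hive_ineqs_def
    by (intro allI impI conjI; rule *, rule rh; simp add: Delta_def)
next
  assume I: "lifted_hive_ineqs N H h"
  have ordered: "h x + h y \<le> h a + h b"
    if "unit_rhombus (lift H x) (lift H y) (lift H a) (lift H b)"
      "x \<in> Delta N" "y \<in> Delta N" "a \<in> Delta N" "b \<in> Delta N"
      "fst a + snd a < fst b + snd b \<or> fst a + snd a = fst b + snd b \<and> fst a < fst b" "fst x + snd x \<le> fst y + snd y" for x y a b
  proof -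
    from lifted_rhombus_ordered[OF that] show ?thesis
      using I unfolding lifted_hive_ineqs_def by (elim exE disjE conjE) (simp_all add: add.commute)
  qed
  show ?L
  proof (intro ballI impI)
    fix x y a b
    assume mem: "x \<in> Delta N" "y \<in> Delta N" "a \<in> Delta N" "b \<in> Delta N"
      and rh: "unit_rhombus (lift H x) (lift H y) (lift H a) (lift H b)"
    have "unit_triangle {lift H x, lift H a, lift H b}"
      using rh by (simp add: unit_rhombus_def)
    from unit_triangle_sqdist(3)[OF this] have "lift H a \<noteq> lift H b"
      by (cases "lift H b") (auto simp: sqdist_def)
    then have "a \<noteq> b" by auto
    then have "(fst a + snd a < fst b + snd b \<or> fst a + snd a = fst b + snd b \<and> fst a < fst b) \<or>
        (fst b + snd b < fst a + snd a \<or> fst b + snd b = fst a + snd a \<and> fst b < fst a)"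
      by (cases a; cases b) auto
    moreover have "fst x + snd x \<le> fst y + snd y \<or> fst y + snd y \<le> fst x + snd x"
      by linarith
    moreover have "unit_rhombus (lift H y) (lift H x) (lift H a) (lift H b)"
      "unit_rhombus (lift H x) (lift H y) (lift H b) (lift H a)"
      "unit_rhombus (lift H y) (lift H x) (lift H b) (lift H a)"
      using rh unit_rhombus_swap by blast+
    ultimately show "h a + h b \<ge> h x + h y"
      using ordered[of x y a b] ordered[of y x a b] ordered[of x y b a] ordered[of y x b a] mem rh
      by linarith
  qed
qed

end

section \<open>Phased paths\<close>

lemma length_phased_path:
  assumes "1 \<le> \<bar>k\<bar>" "\<bar>k\<bar> \<le> int n"
  shows "length (phased_path n k) = 2 * n"
  using assms by (auto simp: phased_path_def length_concat sum_list_replicate)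

lemma nth_concat_replicate2:
  "i < 2 * m \<Longrightarrow> concat (replicate m [a, b]) ! i = (if even i then a else b)"
proof (induction m arbitrary: i)
  case (Suc m)
  then show ?case
    by (cases i; cases "i - 1") auto
qed simp

lemma nth_phased_path:
  assumes "1 \<le> \<bar>k\<bar>" "\<bar>k\<bar> \<le> int n" "p < 2 * n" and m: "m = nat \<bar>k\<bar>"
  shows "phased_path n k ! p = North \<longleftrightarrow> (p < m \<or> p + m < 2 * n \<and> odd (p + m)) \<noteq> (k > 0)"
proof -
  have "1 \<le> m" "m \<le> n"
    using assms by (auto simp: m)
  then have *: "(replicate m a @ concat (replicate (n - m) [b, a]) @ replicate m b) ! p =
      (if p < m \<or> p + m < 2 * n \<and> odd (p + m) then a else b)" for a b :: letter
    using assms(3)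
    by (auto simp: nth_append length_concat sum_list_replicate nth_concat_replicate2)
  show ?thesis
    using *[of West North] *[of North West] assms(1)
    by (cases "k > 0") (auto simp: phased_path_def m)
qed

lemma letter_eq_iff: "c = d \<longleftrightarrow> (c = North \<longleftrightarrow> d = North)"
  by (cases c; cases d) auto

text \<open>
  A phased path consists of constant runs at its ends and an alternating middle part. So a letter
  that occurs again later does so after one or two steps.
\<close>

lemma phased_path_gap:
  assumes k: "1 \<le> \<bar>k\<bar>" "\<bar>k\<bar> \<le> int n" and p: "p < p'" "p' < 2 * n"
    and eq: "phased_path n k ! p' = phased_path n k ! p"
    and ne: "phased_path n k ! Suc p \<noteq> phased_path n k ! p"
  shows "phased_path n k ! Suc (Suc p) = phased_path n k ! p" "p + 2 < 2 * n"
proof -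
  have "p' \<noteq> Suc p" using eq ne by auto
  then have p': "Suc (Suc p) \<le> p'" using p by linarith
  then show *: "p + 2 < 2 * n" using p by linarith
  define m where "m = nat \<bar>k\<bar>"
  have m: "1 \<le> m" "m \<le> n"
    using k by (auto simp: m_def)
  define A where "A = (\<lambda>p. p < m \<or> p + m < 2 * n \<and> odd (p + m))"
  have "phased_path n k ! i = phased_path n k ! j \<longleftrightarrow> (A i \<longleftrightarrow> A j)" if "i < 2 * n" "j < 2 * n" for i j
    using letter_eq_iff[of "phased_path n k ! i" "phased_path n k ! j"] nth_phased_path[OF k that(1) m_def]
      nth_phased_path[OF k that(2) m_def] by (auto simp: A_def)
  then have "A p \<longleftrightarrow> A p'" "\<not> (A p \<longleftrightarrow> A (Suc p))"
    and goal: "phased_path n k ! Suc (Suc p) = phased_path n k ! p \<longleftrightarrow> (A p \<longleftrightarrow> A (Suc (Suc p)))"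
    using eq ne p * by auto
  then have "A p \<longleftrightarrow> A (Suc (Suc p))"
    using p p' m unfolding A_def by (cases "p < m"; cases "p' < m"; cases "p + m < 2 * n"; cases "odd (p + m)") auto
  then show "phased_path n k ! Suc (Suc p) = phased_path n k ! p"
    by (simp add: goal)
qed

lemma ht_0: "ht P 0 = 0"
  by (simp add: ht_def)

lemma ht_Suc: "m < length P \<Longrightarrow> ht P (Suc m) = ht P m + (if P ! m = North then 1 else -1)"
  by (cases "P ! m") (simp_all add: ht_def take_Suc_conv_app_nth)

text \<open>
  Reversing a phased path amounts to exchanging its two letters.
\<close>

lemma nth_phased_path_rev:
  assumes "1 \<le> \<bar>k\<bar>" "\<bar>k\<bar> \<le> int n" "p < 2 * n"
  shows "phased_path n k ! (2 * n - Suc p) = North \<longleftrightarrow> phased_path n k ! p \<noteq> North"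
proof -
  define m where "m = nat \<bar>k\<bar>"
  have m: "1 \<le> m" "m \<le> n"
    using assms by (auto simp: m_def)
  obtain p' where p': "p + p' + 1 = 2 * n" "2 * n - Suc p = p'"
    using assms(3) by (metis Suc_eq_plus1 Suc_leI add_Suc_right diff_add_inverse le_Suc_ex plus_1_eq_Suc add.commute)
  then have "odd (p + p')"
    by (metis even_add even_mult_iff even_numeral odd_one)
  then have "(p' < m \<or> p' + m < 2 * n \<and> odd (p' + m)) \<noteq> (p < m \<or> p + m < 2 * n \<and> odd (p + m))"
    using p'(1) m by auto
  then show ?thesis
    using nth_phased_path[OF assms(1-3) m_def] nth_phased_path[OF assms(1,2) _ m_def, of p'] p' by auto
qed

text \<open>
  This identifies the height of a lifted point on level \<open>m\<close> with the height of the path after \<open>m\<close>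
  letters, so that the entry \<open>m\<close> of a tableau corresponds to the \<open>m\<close>-th letter.
\<close>

lemma ht_phased_path_symmetric:
  assumes "1 \<le> \<bar>k\<bar>" "\<bar>k\<bar> \<le> int n" "m \<le> 2 * n"
  shows "ht (phased_path n k) (2 * n - m) = ht (phased_path n k) m"
  using assms(3)
proof (induction m)
  case 0
  have "ht (phased_path n k) (2 * n) = 0"
    using count_phased_path[OF assms(1,2)] length_phased_path[OF assms(1,2)] by (simp add: ht_def)
  then show ?case by (simp add: ht_0)
next
  case (Suc m)
  then have "ht (phased_path n k) (2 * n - m) = ht (phased_path n k) (2 * n - Suc m) +
      (if phased_path n k ! (2 * n - Suc m) = North then 1 else -1)"
    using ht_Suc[of "2 * n - Suc m" "phased_path n k"] length_phased_path[OF assms(1,2)]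
    by (simp add: Suc_diff_Suc)
  then show ?case
    using Suc nth_phased_path_rev[OF assms(1,2), of m] ht_Suc[of m "phased_path n k"]
      length_phased_path[OF assms(1,2)] by auto
qed

text \<open>
  Positions of two equal letters for which the path is either constant, or alternates in between. The
  first case is where the surface is flat across the middle level, the second where it folds back.
\<close>

definition linked :: "letter list \<Rightarrow> nat \<Rightarrow> nat \<Rightarrow> bool" where
  "linked P p q \<longleftrightarrow> 1 \<le> p \<and> q \<le> length P \<and>
     (q = p + 1 \<and> P ! p = P ! (p - 1) \<or>
      q = p + 2 \<and> P ! p \<noteq> P ! (p - 1) \<and> P ! (p + 1) = P ! (p - 1))"

lemma linkedD: "linked P p q \<Longrightarrow> 1 \<le> p \<and> q \<le> length P \<and> (q = p + 1 \<or> q = p + 2)"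
  unfolding linked_def by blast

lemma count_list_take_mono: "p \<le> q \<Longrightarrow> count_list (take p P) c \<le> count_list (take q P) c"
proof -
  assume "p \<le> q"
  then have "take q P = take p P @ take (q - p) (drop p P)"
    by (metis le_add_diff_inverse take_add)
  then show ?thesis by simp
qed

lemma count_list_take_Suc:
  "p < length P \<Longrightarrow> count_list (take (Suc p) P) c = count_list (take p P) c + (if P ! p = c then 1 else 0)"
  by (simp add: take_Suc_conv_app_nth)

lemma count_list_take_inj:
  assumes "p < length P" "q < length P" "P ! p = c" "P ! q = c"
    "count_list (take p P) c = count_list (take q P) c"
  shows "p = q"
proof (rule ccontr)
  have *: "count_list (take a P) c < count_list (take b P) c"
    if "a < b" "a < length P" "P ! a = c" for a b
    using that count_list_take_mono[of "Suc a" b P c] count_list_take_Suc[of a P c] by simp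
  assume "p \<noteq> q"
  then show False
    using *[of p q] *[of q p] assms by (cases "p < q") auto
qed

lemma letter_pos_count:
  assumes "m < length P" "P ! m = c"
  shows "letter_pos P c (Suc (count_list (take m P) c)) = Suc m"
proof -
  let ?i = "Suc (count_list (take m P) c)"
  have "?i \<le> count_list P c"
    using count_list_take_mono[of "Suc m" "length P" P c] count_list_take_Suc[of m P c] assms by simp
  note s = letter_pos_spec[of ?i P c, OF _ this, simplified]
  have "letter_pos P c ?i - 1 = m"
    by (rule count_list_take_inj[of _ P _ c]) (use s assms in auto)
  then show ?thesis using s(1) by linarith
qed

lemma linked_iff:
  assumes "1 \<le> \<bar>k\<bar>" "\<bar>k\<bar> \<le> int n" and P: "P = phased_path n k"
  shows "linked P p q \<longleftrightarrow>
    (\<exists>c i. 1 \<le> i \<and> i < n \<and> p = letter_pos P c i \<and> q = letter_pos P c (i + 1))"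
proof -
  have len: "length P = 2 * n" and cnt: "count_list P c = n" for c
    using length_phased_path[OF assms(1,2)] count_phased_path[OF assms(1,2)] by (auto simp: P)
  show ?thesis
  proof
    assume l: "linked P p q"
    define c i where "c = P ! (p - 1)" "i = Suc (count_list (take (p - 1) P) c)"
    have p: "1 \<le> p" "p < length P" and q: "P ! (q - 1) = c" "q \<le> length P" "1 \<le> q"
      using l by (auto simp: linked_def c_i_def)
    have lp: "letter_pos P c i = p"
      using letter_pos_count[of "p - 1" P c] p by (simp add: c_i_def)
    have cp: "count_list (take p P) c = i"
      using count_list_take_Suc[of "p - 1" P c] p by (simp add: c_i_def)
    have cq: "count_list (take (q - 1) P) c = i"
    proof -
      from l consider "q = p + 1" | "q = p + 2" "P ! p \<noteq> c"
        by (auto simp: linked_def c_i_def(1))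
      then show ?thesis
        by cases (use count_list_take_Suc[OF p(2), of c] cp in simp_all)
    qed
    have lq: "letter_pos P c (i + 1) = q"
      using letter_pos_count[of "q - 1" P c] q cq by simp
    have "count_list (take (Suc (q - 1)) P) c = i + 1"
      using count_list_take_Suc[of "q - 1" P c] q cq by simp
    then have "i + 1 \<le> n"
      using count_list_take_mono[of "Suc (q - 1)" "length P" P c] q(2,3) cnt[of c] by simp
    then show "\<exists>c i. 1 \<le> i \<and> i < n \<and> p = letter_pos P c i \<and> q = letter_pos P c (i + 1)"
      using lp lq by (intro exI[of _ c] exI[of _ i]) (auto simp: c_i_def(2))
  next
    assume "\<exists>c i. 1 \<le> i \<and> i < n \<and> p = letter_pos P c i \<and> q = letter_pos P c (i + 1)"
    then obtain c i where i: "1 \<le> i" "i < n" and pq: "p = letter_pos P c i" "q = letter_pos P c (i + 1)"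
      by blast
    note sp = letter_pos_spec[of i P c, folded pq] and sq = letter_pos_spec[of "i + 1" P c, folded pq]
    have p: "1 \<le> p" "p \<le> length P" "P ! (p - 1) = c" "count_list (take (p - 1) P) c = i - 1"
      using sp i cnt[of c] by auto
    have q: "1 \<le> q" "q \<le> length P" "P ! (q - 1) = c" "count_list (take (q - 1) P) c = i"
      using sq i cnt[of c] by auto
    have cp: "count_list (take p P) c = i"
      using count_list_take_Suc[of "p - 1" P c] p i by simp
    have "p < q"
      using count_list_take_mono[of "q - 1" "p - 1" P c] p(1,4) q(1,4) i by linarith
    show "linked P p q"
    proof (cases "P ! p = c")
      case True
      have "p < length P" "q - 1 < length P" "count_list (take p P) c = count_list (take (q - 1) P) c"
        using q cp \<open>p < q\<close> by linarith+
      then have "p = q - 1"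
        using True q(3) count_list_take_inj by metis
      then have "q = p + 1"
        using q(1) by linarith
      then show ?thesis
        using True p(1,3) q(2) by (simp add: linked_def)
    next
      case False
      have "P ! Suc (p - 1) \<noteq> P ! (p - 1)"
        using False p by simp
      note gap = phased_path_gap[OF assms(1,2), of "p - 1" "q - 1", folded P, OF _ _ _ this]
      have "p - 1 < q - 1" "q - 1 < 2 * n" "P ! (q - 1) = P ! (p - 1)" "Suc (Suc (p - 1)) = Suc p"
        using p(1,3) q(1-3) \<open>p < q\<close> len by (linarith | simp)+
      with gap[OF this(1-3)] have g: "P ! Suc p = c" "Suc p < length P"
        using p(1,3) len by simp_all
      have "count_list (take (Suc p) P) c = i"
        using count_list_take_Suc[of p P c] g cp False by simp
      then have "count_list (take (Suc p) P) c = count_list (take (q - 1) P) c" "q - 1 < length P"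
        using q by linarith+
      then have "Suc p = q - 1"
        using g q(3) count_list_take_inj by metis
      then have "q = p + 2"
        using q(1) by linarith
      then show ?thesis
        using False p(1,3) q(2) g by (simp add: linked_def)
    qed
  qed
qed

lemma shuffle_letter_pos:
  assumes "1 \<le> \<bar>k\<bar>" "\<bar>k\<bar> \<le> int n" "1 \<le> i" "i \<le> n"
  shows "shuffle n k \<alpha> \<beta> ! (letter_pos (phased_path n k) c i - 1) = (if c = West then \<alpha> else \<beta>) ! (i - 1)"
  using shuffle_West[OF assms, of \<alpha> \<beta>] shuffle_North[OF assms, of \<alpha> \<beta>] by (cases c) simp_all

lemma phased_hive_iff:
  assumes k: "1 \<le> \<bar>k\<bar>" "\<bar>k\<bar> \<le> int n" and P: "P = phased_path n k" and N: "N = 2 * n"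
  shows "phased_hive n k h \<longleftrightarrow> h \<in> extensional (Delta N) \<and>
    (\<forall>i j. i + j + 2 \<le> N \<longrightarrow>
       h (i, j + 2) + h (i + 1, j) \<le> h (i, j + 1) + h (i + 1, j + 1) \<and>
       h (i + 2, j) + h (i, j + 1) \<le> h (i + 1, j) + h (i + 1, j + 1)) \<and>
    (\<forall>i j. linked P (i + j + 1) (i + j + 2) \<longrightarrow>
       h (i, j) + h (i + 1, j + 1) \<le> h (i, j + 1) + h (i + 1, j)) \<and>
    (\<forall>i j. linked P (i + j + 1) (i + j + 3) \<longrightarrow>
       h (i, j) + h (i + 1, j + 2) \<le> h (i, j + 1) + h (i + 1, j + 1) \<and>
       h (i, j) + h (i + 2, j + 1) \<le> h (i + 1, j) + h (i + 1, j + 1))"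
proof -
  define H where "H = (\<lambda>m. ht P (N - m))"
  have len: "length P = N"
    using length_phased_path[OF k] by (simp add: P N)
  have step: "H (Suc m) = H m + (if P ! m = North then 1 else -1)" if "m < N" for m
    using that ht_Suc[of m P] ht_phased_path_symmetric[OF k, of m]
      ht_phased_path_symmetric[OF k, of "Suc m"] by (simp add: H_def P N len[unfolded P N])
  have l1: "linked P (m + 1) (m + 2) \<longleftrightarrow> m + 2 \<le> N \<and> H (m + 2) \<noteq> H m" for m
    using step[of m] step[of "Suc m"] by (cases "P ! m"; cases "P ! Suc m") (auto simp: linked_def len)
  have l2: "linked P (m + 1) (m + 3) \<longleftrightarrow> m + 3 \<le> N \<and> H (m + 2) = H m \<and> H (m + 3) = H (m + 1)" for m
    using step[of m] step[of "Suc m"] step[of "Suc (Suc m)"]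
    by (cases "P ! m"; cases "P ! Suc m"; cases "P ! Suc (Suc m)")
      (auto simp: linked_def len numeral_eq_Suc)
  have "lift_point n k = lift H"
    by (auto simp: lift_point_def lift_def H_def P N fun_eq_iff)
  then have "phased_hive n k h \<longleftrightarrow> h \<in> extensional (Delta N) \<and> lifted_hive_ineqs N H h"
    using lifted_hive_ineqs_iff[of N H h] step by (simp add: phased_hive_def N)
  also have "lifted_hive_ineqs N H h \<longleftrightarrow>
    (\<forall>i j. i + j + 2 \<le> N \<longrightarrow>
       h (i, j + 2) + h (i + 1, j) \<le> h (i, j + 1) + h (i + 1, j + 1) \<and>
       h (i + 2, j) + h (i, j + 1) \<le> h (i + 1, j) + h (i + 1, j + 1)) \<and>
    (\<forall>i j. linked P (i + j + 1) (i + j + 2) \<longrightarrow>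
       h (i, j) + h (i + 1, j + 1) \<le> h (i, j + 1) + h (i + 1, j)) \<and>
    (\<forall>i j. linked P (i + j + 1) (i + j + 3) \<longrightarrow>
       h (i, j) + h (i + 1, j + 2) \<le> h (i, j + 1) + h (i + 1, j + 1) \<and>
       h (i, j) + h (i + 2, j + 1) \<le> h (i + 1, j) + h (i + 1, j + 1))"
    unfolding lifted_hive_ineqs_def l1 l2 by blast
  finally show ?thesis .
qed

section \<open>Row lengths of a tableau\<close>

lemma part_seq_nth:
  assumes "part_seq m xs"
  shows "length xs = m" "i < m \<Longrightarrow> 0 \<le> xs ! i" "i \<le> j \<Longrightarrow> j < m \<Longrightarrow> xs ! j \<le> xs ! i"
proof -
  show len: "length xs = m"
    using assms by (simp add: part_seq_def)
  show "0 \<le> xs ! i" if "i < m"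
    using assms that len by (simp add: part_seq_def)
  show "xs ! j \<le> xs ! i" if "i \<le> j" "j < m"
    using assms that len by (cases "i = j") (auto simp: part_seq_def sorted_wrt_iff_nth_less)
qed

lemma finite_diagram: "finite (diagram \<kappa>)"
proof (rule finite_subset)
  show "diagram \<kappa> \<subseteq> (SIGMA a:{1..length \<kappa>}. {..nat (\<kappa> ! (a - 1))})"
    by (auto simp: diagram_def)
qed auto

locale bounded_tableau =
  fixes N :: nat and \<kappa> :: "int list" and T :: "nat \<times> nat \<Rightarrow> nat"
  assumes shape: "part_seq N \<kappa>" and ssyt: "ssyt \<kappa> T" and le_N: "s \<in> diagram \<kappa> \<Longrightarrow> T s \<le> N"
begin

abbreviation x where "x \<equiv> sub_shape \<kappa> T"

lemma mem_diagram: "(a, c) \<in> diagram \<kappa> \<longleftrightarrow> 1 \<le> a \<and> a \<le> N \<and> 1 \<le> c \<and> int c \<le> \<kappa> ! (a - 1)"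
  using part_seq_nth(1)[OF shape] by (auto simp: diagram_def)

lemma diagram_up: "(a, c) \<in> diagram \<kappa> \<Longrightarrow> 1 \<le> a' \<Longrightarrow> a' \<le> a \<Longrightarrow> 1 \<le> c' \<Longrightarrow> c' \<le> c \<Longrightarrow> (a', c') \<in> diagram \<kappa>"
  using part_seq_nth(3)[OF shape, of "a' - 1" "a - 1"] unfolding mem_diagram by fastforce

lemma T_ge_1: "s \<in> diagram \<kappa> \<Longrightarrow> 1 \<le> T s"
  using ssyt by (auto simp: ssyt_def)

lemma T_row:
  assumes "(a, c') \<in> diagram \<kappa>" "1 \<le> c" "c \<le> c'"
  shows "T (a, c) \<le> T (a, c')"
proof -
  have "(a, c) \<in> diagram \<kappa>"
    by (rule diagram_up[OF assms(1)]) (use assms in \<open>auto simp: mem_diagram\<close>)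
  then show ?thesis
    using ssyt assms unfolding ssyt_def by blast
qed

lemma T_col:
  assumes "(a, c) \<in> diagram \<kappa>" "1 \<le> a'" "a' < a"
  shows "T (a', c) < T (a, c)"
proof -
  have "(a', c) \<in> diagram \<kappa>"
    by (rule diagram_up[OF assms(1)]) (use assms in \<open>auto simp: mem_diagram\<close>)
  then show ?thesis
    using ssyt assms unfolding ssyt_def by blast
qed

text \<open>
  Rows are weakly increasing, so the entries at most \<open>i\<close> of a row form an initial segment.
\<close>

lemma row_set_eq:
  "{c. (a, c) \<in> diagram \<kappa> \<and> T (a, c) \<le> i} = {1..nat (x i a)}"
proof -
  let ?S = "{c. (a, c) \<in> diagram \<kappa> \<and> T (a, c) \<le> i}"
  have fin: "finite ?S"
    by (rule finite_subset[of _ "{..nat (\<kappa> ! (a - 1))}"]) (auto simp: mem_diagram)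
  have "\<exists>m. ?S = {1..m}"
  proof (cases "?S = {}")
    case True
    then show ?thesis by (intro exI[of _ 0]) auto
  next
    case False
    define m where "m = Max ?S"
    have m: "m \<in> ?S" and max: "\<And>c. c \<in> ?S \<Longrightarrow> c \<le> m"
      using Max_in[OF fin False] Max_ge[OF fin] by (auto simp: m_def)
    have "c \<in> ?S" if "1 \<le> c" "c \<le> m" for c
      using m that T_row[of a m c] diagram_up[of a m a c] by (auto simp: mem_diagram)
    moreover have "1 \<le> c" "c \<le> m" if "c \<in> ?S" for c
      using that max[OF that] by (simp_all add: mem_diagram)
    ultimately have "?S = {1..m}"
      unfolding set_eq_iff atLeastAtMost_iff by blast
    then show ?thesis by blast
  qed
  then obtain m where m: "?S = {1..m}" by blast
  then show ?thesis by (simp add: sub_shape_def)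
qed

lemma le_x_iff:
  "1 \<le> c \<Longrightarrow> int c \<le> x i a \<longleftrightarrow> (a, c) \<in> diagram \<kappa> \<and> T (a, c) \<le> i"
  using arg_cong[OF row_set_eq[of a i], of "\<lambda>S. c \<in> S"] by auto

lemma x_nonneg: "0 \<le> x i a"
  by (simp add: sub_shape_def)

lemma x_leI:
  assumes "\<And>c. 1 \<le> c \<Longrightarrow> (a, c) \<in> diagram \<kappa> \<Longrightarrow> T (a, c) \<le> i \<Longrightarrow> int c \<le> u" "0 \<le> u"
  shows "x i a \<le> u"
proof (cases "x i a = 0")
  case False
  then have "1 \<le> nat (x i a)" "int (nat (x i a)) \<le> x i a"
    using x_nonneg[of i a] by auto
  then have "int (nat (x i a)) \<le> u"
    using le_x_iff[of "nat (x i a)" i a] assms(1)[of "nat (x i a)"] by simp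
  then show ?thesis using x_nonneg[of i a] by simp
qed (use assms(2) in simp)

lemma x_mono: "i \<le> j \<Longrightarrow> x i a \<le> x j a"
proof (rule x_leI[OF _ x_nonneg])
  fix c assume "i \<le> j" "1 \<le> c" "(a, c) \<in> diagram \<kappa>" "T (a, c) \<le> i"
  then show "int c \<le> x j a"
    using le_x_iff[of c j a] by linarith
qed

lemma x_interlace: "1 \<le> a \<Longrightarrow> x (Suc i) (Suc a) \<le> x i a"
proof (rule x_leI[OF _ x_nonneg])
  fix c assume a: "1 \<le> a" and c: "1 \<le> c" "(Suc a, c) \<in> diagram \<kappa>" "T (Suc a, c) \<le> Suc i"
  have "(a, c) \<in> diagram \<kappa>" "T (a, c) < T (Suc a, c)"
    using diagram_up[OF c(2), of a c] T_col[OF c(2), of a] a c by simp_all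
  then show "int c \<le> x i a"
    using c le_x_iff[of c i a] by linarith
qed

lemma T_ge_row: "(a, c) \<in> diagram \<kappa> \<Longrightarrow> a \<le> T (a, c)"
proof (induction a)
  case (Suc a)
  show ?case
  proof (cases "a = 0")
    case False
    then have "(a, c) \<in> diagram \<kappa>" "T (a, c) < T (Suc a, c)"
      using diagram_up[OF Suc.prems, of a c] T_col[OF Suc.prems, of a] Suc.prems mem_diagram by simp_all
    then show ?thesis using Suc.IH by simp
  qed (use T_ge_1[OF Suc.prems] in simp)
qed simp

lemma x_eq_0: "i < a \<or> a = 0 \<or> N < a \<Longrightarrow> x i a = 0"
proof (rule antisym[OF x_leI x_nonneg])
  fix c assume "i < a \<or> a = 0 \<or> N < a" "(a, c) \<in> diagram \<kappa>" "T (a, c) \<le> i"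
  then show "int c \<le> 0"
    using T_ge_row[of a c] mem_diagram[of a c] by linarith
qed simp

lemma x_last: "1 \<le> a \<Longrightarrow> a \<le> N \<Longrightarrow> N \<le> i \<Longrightarrow> x i a = \<kappa> ! (a - 1)"
proof (rule antisym)
  assume a: "1 \<le> a" "a \<le> N" "N \<le> i"
  have k: "0 \<le> \<kappa> ! (a - 1)"
    using part_seq_nth(2)[OF shape, of "a - 1"] a by simp
  show "x i a \<le> \<kappa> ! (a - 1)"
    by (rule x_leI) (use k in \<open>auto simp: mem_diagram\<close>)
  show "\<kappa> ! (a - 1) \<le> x i a"
  proof (cases "\<kappa> ! (a - 1) = 0")
    case False
    then have "1 \<le> nat (\<kappa> ! (a - 1))" "(a, nat (\<kappa> ! (a - 1))) \<in> diagram \<kappa>"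
      using a k mem_diagram by simp_all
    then have "int (nat (\<kappa> ! (a - 1))) \<le> x i a"
      using le_x_iff[of "nat (\<kappa> ! (a - 1))" i a] le_N[of "(a, nat (\<kappa> ! (a - 1)))"] a(3) by linarith
    then show ?thesis using k by simp
  qed (simp add: x_nonneg)
qed

definition cells :: "nat \<Rightarrow> nat \<Rightarrow> int" where
  "cells v j = (\<Sum>a = 1..j. x v a - x (v - 1) a)"

lemma cells_0: "cells v 0 = 0"
  by (simp add: cells_def)

lemma cells_Suc: "cells v (Suc j) = cells v j + (x v (Suc j) - x (v - 1) (Suc j))"
  by (simp add: cells_def)

lemma cells_mono: "i \<le> j \<Longrightarrow> cells v i \<le> cells v j"
  by (rule lift_Suc_mono_le) (auto simp: cells_Suc x_mono)

lemma cells_stable: "v \<le> j \<Longrightarrow> cells v j = cells v v"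
proof (induction rule: dec_induct)
  case (step j)
  then have "x v (Suc j) = 0" "x (v - 1) (Suc j) = 0"
    using step.hyps by (intro x_eq_0 disjI1; linarith)+
  then show ?case using step by (simp add: cells_Suc)
qed simp

lemma cells_stable_N: "N \<le> j \<Longrightarrow> cells v j = cells v N"
  by (induction rule: dec_induct) (auto simp: cells_Suc x_eq_0)

lemma entry_iff: "1 \<le> c \<Longrightarrow> 1 \<le> v \<Longrightarrow>
    (a, c) \<in> diagram \<kappa> \<and> T (a, c) = v \<longleftrightarrow> x (v - 1) a < int c \<and> int c \<le> x v a"
  using le_x_iff[of c v a] le_x_iff[of c "v - 1" a] by auto

lemma card_entries_rows:
  assumes "1 \<le> v"
  shows "int (card {s \<in> diagram \<kappa>. T s = v \<and> fst s \<le> j}) = cells v j"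
proof (induction j)
  case 0
  have none: "{s \<in> diagram \<kappa>. T s = v \<and> fst s \<le> 0} = {}"
    by (auto simp: mem_diagram)
  show ?case
    unfolding none by (simp add: cells_0)
next
  case (Suc j)
  let ?S = "\<lambda>j. {s \<in> diagram \<kappa>. T s = v \<and> fst s \<le> j}"
  let ?C = "{c. (Suc j, c) \<in> diagram \<kappa> \<and> T (Suc j, c) = v}"
  let ?R = "Pair (Suc j) ` ?C"
  have mem: "c \<in> ?C \<longleftrightarrow> x (v - 1) (Suc j) < int c \<and> int c \<le> x v (Suc j)" for c
    using entry_iff[OF _ assms, of c "Suc j"] x_nonneg[of "v - 1" "Suc j"] mem_diagram[of "Suc j" c]
    by (cases "c = 0") auto
  have R: "?C = {nat (x (v - 1) (Suc j))<..nat (x v (Suc j))}"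
    unfolding set_eq_iff mem using x_nonneg[of "v - 1" "Suc j"] by auto
  have "?S (Suc j) = ?S j \<union> ?R"
    by (auto simp: le_Suc_eq)
  moreover have "?S j \<inter> ?R = {}"
    by auto
  moreover have "int (card ?R) = x v (Suc j) - x (v - 1) (Suc j)"
    unfolding R using x_nonneg[of "v - 1" "Suc j"] x_nonneg[of v "Suc j"] x_mono[of "v - 1" v "Suc j"]
    by (subst card_image) (auto simp: inj_on_def)
  moreover have "finite ?R"
    unfolding R by simp
  ultimately show ?case
    using finite_diagram Suc.IH card_Un_disjoint[of "?S j" ?R] by (simp add: cells_Suc)
qed

lemma card_entries:
  assumes "1 \<le> v"
  shows "int (card {s \<in> diagram \<kappa>. T s = v}) = cells v N"
proof -
  have "{s \<in> diagram \<kappa>. T s = v} = {s \<in> diagram \<kappa>. T s = v \<and> fst s \<le> N}"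
    by (auto simp: mem_diagram)
  then show ?thesis
    using card_entries_rows[OF assms, of N] by simp
qed

end

text \<open>
  The tableau has in square \<open>(a, c)\<close> the first level whose row \<open>a\<close> reaches column \<open>c\<close>. Only
  the entries \<open>z m a\<close> with \<open>a \<le> m\<close> matter, because entries in row \<open>a\<close> of a semistandard tableau are
  at least \<open>a\<close>.
\<close>

lemma tableau_of_pattern:
  fixes z :: "nat \<Rightarrow> nat \<Rightarrow> int"
  assumes shape: "part_seq N \<kappa>"
    and mono: "\<And>m a. 1 \<le> a \<Longrightarrow> a \<le> m \<Longrightarrow> m < N \<Longrightarrow> z m a \<le> z (Suc m) a"
    and inter: "\<And>m a. 1 \<le> a \<Longrightarrow> a \<le> m \<Longrightarrow> m < N \<Longrightarrow> z (Suc m) (Suc a) \<le> z m a"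
    and last: "\<And>a. 1 \<le> a \<Longrightarrow> a \<le> N \<Longrightarrow> z N a = \<kappa> ! (a - 1)"
  shows "\<exists>T. bounded_tableau N \<kappa> T \<and>
    (\<forall>m a. 1 \<le> a \<longrightarrow> a \<le> m \<longrightarrow> m \<le> N \<longrightarrow> sub_shape \<kappa> T m a = z m a)"
proof -
  have len: "length \<kappa> = N"
    using part_seq_nth(1)[OF shape] .
  have mono': "z m a \<le> z m' a" if "1 \<le> a" "a \<le> m" "m \<le> m'" "m' \<le> N" for m m' a
    using that(3,4)
  proof (induction m' rule: dec_induct)
    case (step m')
    then show ?case using mono[of a m'] that by simp
  qed simp
  have inter': "z (m + d) (a + d) \<le> z m a" if "1 \<le> a" "a \<le> m" "m + d \<le> N" for m a d
    using that(3)
  proof (induction d)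
    case (Suc d)
    then show ?case using inter[of "a + d" "m + d"] that by simp
  qed simp
  have nonneg: "0 \<le> z m a" if "1 \<le> a" "a \<le> m" "m \<le> N" for m a
  proof -
    have "0 \<le> \<kappa> ! (N - 1)"
      using part_seq_nth(2)[OF shape, of "N - 1"] that by simp
    also have "\<dots> = z (a + (N - a)) (a + (N - a))"
      using last[of N] that by simp
    also have "\<dots> \<le> z a a"
      using that by (intro inter') auto
    also have "\<dots> \<le> z m a"
      using mono'[of a a m] that by simp
    finally show ?thesis .
  qed
  define t where "t = (\<lambda>(a, c). LEAST m. a \<le> m \<and> int c \<le> z m a)"
  have t_le: "t (a, c) \<le> m \<longleftrightarrow> int c \<le> z m a"
    if d: "(a, c) \<in> diagram \<kappa>" and m: "a \<le> m" "m \<le> N" for a c m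
  proof -
    have a: "1 \<le> a" using d by (simp add: diagram_def)
    show ?thesis
    proof
      assume le: "t (a, c) \<le> m"
      have "a \<le> t (a, c) \<and> int c \<le> z (t (a, c)) a"
        unfolding t_def prod.case
        by (rule LeastI[of _ N]) (use d m last[of a] len in \<open>auto simp: diagram_def\<close>)
      then show "int c \<le> z m a"
        using mono'[of a "t (a, c)" m] le m a by linarith
    next
      assume "int c \<le> z m a"
      then show "t (a, c) \<le> m"
        unfolding t_def prod.case using m by (intro Least_le) auto
    qed
  qed
  have t_N: "t (a, c) \<le> N" if "(a, c) \<in> diagram \<kappa>" for a c
    using that t_le[of a c N] last[of a] len by (auto simp: diagram_def)
  have t_a: "a \<le> t (a, c)" if d: "(a, c) \<in> diagram \<kappa>" for a c
    unfolding t_def prod.case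
    by (rule LeastI2[of _ N]) (use d last[of a] len in \<open>auto simp: diagram_def\<close>)
  define T where "T = restrict t (diagram \<kappa>)"
  have T: "T s = t s" if "s \<in> diagram \<kappa>" for s
    using that by (simp add: T_def)
  have "ssyt \<kappa> T"
    unfolding ssyt_def
  proof (intro conjI ballI allI impI)
    show "T \<in> extensional (diagram \<kappa>)"
      by (simp add: T_def)
    show "1 \<le> T s" if "s \<in> diagram \<kappa>" for s
      using that t_a[of "fst s" "snd s"] by (auto simp: T diagram_def)
    show "T (r, c) \<le> T (r, c')" if "(r, c) \<in> diagram \<kappa>" "(r, c') \<in> diagram \<kappa>" "c \<le> c'" for r c c'
    proof -
      have "int c' \<le> z (t (r, c')) r"
        using t_le[of r c' "t (r, c')"] t_a t_N that by simp
      then show ?thesis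
        using t_le[of r c "t (r, c')"] t_a t_N that by (simp add: T)
    qed
    show "T (r, c) < T (r', c)" if d: "(r, c) \<in> diagram \<kappa>" "(r', c) \<in> diagram \<kappa>" "r < r'" for r r' c
    proof -
      define d m where "d = r' - r" and "m = t (r', c) - d"
      have le: "r' \<le> t (r', c)" "t (r', c) \<le> N"
        using t_a t_N that by auto
      have eq: "r' = r + d" "t (r', c) = m + d" "0 < d" "r \<le> m"
        using le \<open>r < r'\<close> by (auto simp: d_def m_def)
      have "int c \<le> z (t (r', c)) r'"
        using t_le[of r' c "t (r', c)"] le that(2) by simp
      also have "\<dots> = z (m + d) (r + d)"
        by (metis eq(1,2))
      also have "\<dots> \<le> z m r"
        using inter'[of r m d] le eq that(1) by (simp add: diagram_def)
      finally have "t (r, c) \<le> m"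
        using t_le[of r c m] eq(2,4) le that(1) by simp
      then show ?thesis
        using eq(2,3) T[OF that(1)] T[OF that(2)] by linarith
    qed
  qed
  then have b: "bounded_tableau N \<kappa> T"
    using shape t_N by unfold_locales (auto simp: T)
  moreover have "sub_shape \<kappa> T m a = z m a" if "1 \<le> a" "a \<le> m" "m \<le> N" for m a
  proof -
    have "z m a \<le> \<kappa> ! (a - 1)"
      using mono'[of a m N] last[of a] that by simp
    then have "{c. (a, c) \<in> diagram \<kappa> \<and> T (a, c) \<le> m} = {1..nat (z m a)}"
      using that len t_le[of a _ m] by (auto simp: diagram_def T)
    then show ?thesis
      using nonneg[OF that] by (simp add: sub_shape_def)
  qed
  ultimately show ?thesis
    by blast
qed

section \<open>Disjoint northeast pairs\<close>

context bounded_tableau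
begin

text \<open>
  The counting half of Hall's theorem. The entries \<open>q\<close> outside \<open>B\<close> account for at most
  \<open>cells q N - card B\<close> pairs, those in \<open>B\<close> for at most \<open>card A\<close>.
\<close>

lemma ne_pairs_bound:
  assumes pairs: "has_ne_pairs \<kappa> T a p q" and "p \<noteq> q" "1 \<le> q"
    and A: "finite A" and B: "B \<subseteq> {t \<in> diagram \<kappa>. T t = q}"
    and AB: "\<And>s t. s \<in> diagram \<kappa> \<Longrightarrow> t \<in> B \<Longrightarrow> T s = p \<Longrightarrow> northeast s t \<Longrightarrow> s \<in> A"
  shows "int a + int (card B) \<le> int (card A) + cells q N"
proof -
  let ?Q = "{t \<in> diagram \<kappa>. T t = q}"
  from pairs obtain M where *: "M \<subseteq> diagram \<kappa> \<times> diagram \<kappa> \<and> a \<le> card M \<and>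
      (\<forall>(s, t)\<in>M. T s = p \<and> T t = q \<and> northeast s t) \<and>
      pairwise (\<lambda>(s, t) (s', t'). disjnt {s, t} {s', t'}) M"
    unfolding has_ne_pairs_def by (elim exE)
  then have M: "M \<subseteq> diagram \<kappa> \<times> diagram \<kappa>" "a \<le> card M"
    and disj: "pairwise (\<lambda>(s, t) (s', t'). disjnt {s, t} {s', t'}) M"
    by simp_all
  have MD: "T s = p \<and> T t = q \<and> northeast s t" if "(s, t) \<in> M" for s t
    using * that by auto
  have fin: "finite M" "finite ?Q"
    using finite_subset[OF M(1)] finite_diagram by simp_all
  have inj: "inj_on fst M" "inj_on snd M"
  proof -
    have "m = m'" if "m \<in> M" "m' \<in> M" "fst m = fst m' \<or> snd m = snd m'" for m m'
      using pairwiseD[OF disj that(1,2)] that(3) by (cases m; cases m') (auto simp: disjnt_def)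
    then show "inj_on fst M" "inj_on snd M"
      by (blast intro: inj_onI)+
  qed
  define M1 M2 where "M1 = {m \<in> M. snd m \<in> B}" and "M2 = {m \<in> M. snd m \<notin> B}"
  have "card M1 = card (fst ` M1)"
    by (rule card_image[symmetric]) (rule inj_on_subset[OF inj(1)], auto simp: M1_def)
  also have "\<dots> \<le> card A"
  proof (rule card_mono[OF A], rule image_subsetI)
    fix m assume m: "m \<in> M1"
    then have "m \<in> M" "snd m \<in> B" "fst m \<in> diagram \<kappa>"
      using M(1) by (auto simp: M1_def)
    then show "fst m \<in> A"
      using MD[of "fst m" "snd m"] AB[of "fst m" "snd m"] by simp
  qed
  finally have 1: "card M1 \<le> card A" .
  have "card M2 = card (snd ` M2)"
    by (rule card_image[symmetric]) (rule inj_on_subset[OF inj(2)], auto simp: M2_def)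
  also have "\<dots> \<le> card (?Q - B)"
  proof (rule card_mono, use fin in simp, rule image_subsetI)
    fix m assume m: "m \<in> M2"
    then have "m \<in> M" "snd m \<notin> B" "snd m \<in> diagram \<kappa>"
      using M(1) by (auto simp: M2_def)
    then show "snd m \<in> ?Q - B"
      using MD[of "fst m" "snd m"] by simp
  qed
  also have "\<dots> = card ?Q - card B"
    using B fin by (intro card_Diff_subset) (auto intro: finite_subset)
  finally have "card M2 \<le> card ?Q - card B" .
  moreover have "card B \<le> card ?Q"
    using B fin by (intro card_mono)
  moreover have "card M = card M1 + card M2"
    using fin(1) by (subst card_Un_disjoint[symmetric]) (auto simp: M1_def M2_def intro!: arg_cong[of _ _ card])
  ultimately show ?thesis
    using 1 M(2) card_entries[OF \<open>1 \<le> q\<close>] by linarith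
qed

text \<open>
  Within a row, the smaller entry lies strictly to the left of the larger one.
\<close>

lemma northeast_higher_row:
  assumes "s \<in> diagram \<kappa>" "t \<in> diagram \<kappa>" "northeast s t" "T s < T t"
  shows "fst s < fst t"
proof (rule ccontr)
  obtain r c r' c' where st: "s = (r', c')" "t = (r, c)"
    by (metis surj_pair)
  assume "\<not> fst s < fst t"
  then have "r' = r" "c \<le> c'"
    using assms(3) by (auto simp: st northeast_def)
  then have "T t \<le> T s"
    using T_row[of r c' c] assms(1,2) by (simp add: st mem_diagram)
  then show False
    using assms(4) by simp
qed

text \<open>
  An entry \<open>q\<close> in the first \<open>j + 1\<close> rows has its partner \<open>p\<close> in the first \<open>j\<close> rows. So does an
  entry \<open>q\<close> in row \<open>j + 2\<close> that lies to the right of column \<open>x p (j + 1)\<close>, because no entry \<open>p\<close> of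
  row \<open>j + 1\<close> reaches so far. The second inequality bounds the number of all these entries. Since
  \<open>q \<le> p + 2\<close>, interlacing puts the entries smaller than \<open>q\<close> in row \<open>j + 2\<close> to the left of that
  column, so every square counted does contain \<open>q\<close>.
\<close>

lemma ineqs_of_ne_pairs:
  assumes p: "1 \<le> p" and q: "q = p + 1 \<or> q = p + 2"
    and pairs: "has_ne_pairs \<kappa> T a p q"
  shows "cells q (Suc j) \<le> cells p j + (cells q N - int a)"
    and "cells q (Suc j) + x q (Suc (Suc j)) \<le> cells p j + x p (Suc j) + (cells q N - int a)"
proof -
  have pq: "p < q" "1 \<le> q" "p \<noteq> q"
    using q by auto
  let ?A = "{s \<in> diagram \<kappa>. T s = p \<and> fst s \<le> j}"
  let ?B = "{t \<in> diagram \<kappa>. T t = q \<and> fst t \<le> Suc j}"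
  let ?C = "Pair (Suc (Suc j)) ` {nat (x p (Suc j))<..nat (x q (Suc (Suc j)))}"
  have "int a + int (card ?B) \<le> int (card ?A) + cells q N"
    by (rule ne_pairs_bound[OF pairs pq(3,2)])
      (use finite_diagram northeast_higher_row pq in \<open>fastforce+\<close>)
  then show "cells q (Suc j) \<le> cells p j + (cells q N - int a)"
    using card_entries_rows[OF p] card_entries_rows[OF pq(2)] by simp
  have "x (q - 1) (Suc (Suc j)) \<le> x (Suc p) (Suc (Suc j))"
    using q by (intro x_mono) auto
  also have "\<dots> \<le> x p (Suc j)"
    by (rule x_interlace) simp
  finally have le: "x (q - 1) (Suc (Suc j)) \<le> x p (Suc j)" .
  have C: "(Suc (Suc j), c) \<in> diagram \<kappa> \<and> T (Suc (Suc j), c) = q \<and> x p (Suc j) < int c"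
    if "nat (x p (Suc j)) < c" "c \<le> nat (x q (Suc (Suc j)))" for c
    using that le x_nonneg[of p "Suc j"] entry_iff[of c q "Suc (Suc j)"] pq by linarith
  have "int a + int (card (?B \<union> ?C)) \<le> int (card ?A) + cells q N"
  proof (rule ne_pairs_bound[OF pairs pq(3,2)])
    fix s t assume s: "s \<in> diagram \<kappa>" "T s = p" "northeast s t" and t: "t \<in> ?B \<union> ?C"
    obtain r' c' where s': "s = (r', c')" by (cases s)
    from t have td: "t \<in> diagram \<kappa>" "T t = q"
      using C by auto
    then have lt: "fst s < fst t"
      using northeast_higher_row[of s t] s pq by simp
    have "r' \<le> j"
    proof (cases "t \<in> ?B")
      case False
      then obtain c where c: "t = (Suc (Suc j), c)" "x p (Suc j) < int c"
        using t C by auto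
      have "int c' \<le> x p r'" "int c \<le> int c'"
        using entry_iff[of c' p r'] s s' p mem_diagram[of r' c'] c(1) by (auto simp: northeast_def)
      then have "r' \<noteq> Suc j"
        using c(2) by auto
      then show ?thesis
        using lt s' c(1) by simp
    qed (use lt s' in auto)
    then show "s \<in> ?A"
      using s s' by simp
  qed (use finite_diagram C in auto)
  moreover have "card (?B \<union> ?C) = card ?B + card ?C"
    using finite_diagram by (intro card_Un_disjoint) auto
  moreover have "card ?C = nat (x q (Suc (Suc j))) - nat (x p (Suc j))"
    by (subst card_image) (auto simp: inj_on_def)
  then have "x q (Suc (Suc j)) - x p (Suc j) \<le> int (card ?C)"
    using x_nonneg[of p "Suc j"] x_nonneg[of q "Suc (Suc j)"] by linarith
  ultimately show "cells q (Suc j) + x q (Suc (Suc j)) \<le> cells p j + x p (Suc j) + (cells q N - int a)"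
    using card_entries_rows[OF p, of j] card_entries_rows[OF pq(2), of "Suc j"] by linarith
qed

text \<open>
  Squares with entry \<open>v\<close> are numbered from \<open>1\<close>, row by row from the top, and from right to left
  within a row.
\<close>

definition reading_row :: "nat \<Rightarrow> nat \<Rightarrow> nat" where
  "reading_row v l = (LEAST r. int l \<le> cells v r)"

definition reading_col :: "nat \<Rightarrow> nat \<Rightarrow> nat" where
  "reading_col v l = nat (x v (reading_row v l) + cells v (reading_row v l - 1) + 1 - int l)"

lemma reading_row_le: "int l \<le> cells v r \<Longrightarrow> reading_row v l \<le> r"
  unfolding reading_row_def by (rule Least_le)

lemma reading:
  assumes v: "1 \<le> v" and l: "1 \<le> l" "int l \<le> cells v N"
  shows "1 \<le> reading_row v l" "int l \<le> cells v (reading_row v l)"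
    "int (reading_col v l) = x v (reading_row v l) + cells v (reading_row v l - 1) + 1 - int l"
    "(reading_row v l, reading_col v l) \<in> diagram \<kappa>" "T (reading_row v l, reading_col v l) = v"
proof -
  define r where "r = reading_row v l"
  show le: "int l \<le> cells v (reading_row v l)"
    unfolding reading_row_def by (rule LeastI[of _ N]) (rule l(2))
  then show r: "1 \<le> reading_row v l"
    using cells_0[of v] l(1) by (cases "reading_row v l") auto
  have "\<not> int l \<le> cells v (r - 1)"
    using reading_row_le[of l v "r - 1"] r by (auto simp: r_def)
  moreover have "cells v r = cells v (r - 1) + (x v r - x (v - 1) r)"
    using cells_Suc[of v "r - 1"] r by (simp add: r_def)
  ultimately have b: "x (v - 1) r < x v r + cells v (r - 1) + 1 - int l" "x v r + cells v (r - 1) + 1 - int l \<le> x v r"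
    using le by (auto simp: r_def)
  then show c: "int (reading_col v l) = x v (reading_row v l) + cells v (reading_row v l - 1) + 1 - int l"
    using x_nonneg[of "v - 1" r] by (simp add: reading_col_def r_def)
  have "1 \<le> reading_col v l"
    using b x_nonneg[of "v - 1" r] c unfolding r_def by linarith
  then have "(r, reading_col v l) \<in> diagram \<kappa> \<and> T (r, reading_col v l) = v"
    using b entry_iff[of "reading_col v l" v r] v c unfolding r_def by simp
  then show "(reading_row v l, reading_col v l) \<in> diagram \<kappa>" "T (reading_row v l, reading_col v l) = v"
    by (simp_all add: r_def)
qed

text \<open>
  The \<open>l\<close>-th entry \<open>p\<close> in reading order is paired with the \<open>(l + d)\<close>-th entry \<open>q\<close>. If the latter
  lies in row \<open>r\<close>, the first inequality for \<open>j = r - 1\<close> puts the former in a row \<open>r' < r\<close>. The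
  comparison of the columns is then the second inequality for the row \<open>r'\<close>, after replacing
  \<open>cells q (r - 1) + x q r\<close> by the same expression for \<open>r'\<close>, which is larger by interlacing.
\<close>

lemma ne_pairs_of_ineqs:
  assumes p: "1 \<le> p" "p < q" and d: "0 \<le> d" "int a + d \<le> cells q N"
    and rows: "\<And>j. cells q (Suc j) \<le> cells p j + d"
    and cols: "\<And>j. cells q (Suc j) + x q (Suc (Suc j)) \<le> cells p j + x p (Suc j) + d"
  shows "has_ne_pairs \<kappa> T a p q"
proof -
  define D where "D = nat d"
  have D: "int D = d"
    using d by (simp add: D_def)
  define P where "P = (\<lambda>l. (reading_row p l, reading_col p l))"
  define Q where "Q = (\<lambda>l. (reading_row q (l + D), reading_col q (l + D)))"
  have q: "1 \<le> q" using p by simp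
  have bq: "1 \<le> l + D" "int (l + D) \<le> cells q N" if "l \<in> {1..a}" for l
    using that d D by auto
  have bp: "1 \<le> l" "int l \<le> cells p N" if "l \<in> {1..a}" for l
    using that rows[of N] d cells_stable_N[of "Suc N" q] by auto
  note rp = reading[OF p(1) bp] and rq = reading[OF q bq]
  have mem: "P l \<in> diagram \<kappa>" "T (P l) = p" "Q l \<in> diagram \<kappa>" "T (Q l) = q" if "l \<in> {1..a}" for l
    using rp(4,5)[OF that that] rq(4,5)[OF that that] by (simp_all add: P_def Q_def)
  have g: "cells q r + x q (Suc r) \<le> cells q r' + x q (Suc r')" if "r' \<le> r" for r r'
    using that
  proof (induction r rule: dec_induct)
    case (step r)
    then show ?case
      using cells_Suc[of q r] x_interlace[of "Suc r" "q - 1"] q by simp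
  qed simp
  have ne: "northeast (P l) (Q l)" if l: "l \<in> {1..a}" for l
  proof -
    define r r' where "r = reading_row q (l + D)" and "r' = reading_row p l"
    have r: "1 \<le> r" "1 \<le> r'" "int (l + D) \<le> cells q r"
      using rp[OF l l] rq[OF l l] by (auto simp: r_def r'_def)
    have "int l \<le> cells p (r - 1)"
      using rows[of "r - 1"] r D by simp
    then have rr: "r' \<le> r - 1"
      unfolding r'_def by (rule reading_row_le)
    have "cells q (r - 1) + x q r \<le> cells q r' + x q (Suc r')"
      using g[OF rr] r by simp
    also have "\<dots> \<le> cells p (r' - 1) + x p r' + d"
      using cols[of "r' - 1"] r by simp
    finally have "int (reading_col q (l + D)) \<le> int (reading_col p l)"
      using rp(3)[OF l l] rq(3)[OF l l] D unfolding r_def[symmetric] r'_def[symmetric] by simp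
    then show ?thesis
      using rr by (simp add: northeast_def P_def Q_def r_def r'_def)
  qed
  have inj: "P l = P l' \<Longrightarrow> l = l'" "Q l = Q l' \<Longrightarrow> l = l'" if "l \<in> {1..a}" "l' \<in> {1..a}" for l l'
  proof -
    show "l = l'" if "P l = P l'"
    proof -
      have "reading_row p l = reading_row p l'" "reading_col p l = reading_col p l'"
        using that by (simp_all add: P_def)
      note e = this
      show ?thesis
        using rp(3)[OF \<open>l \<in> {1..a}\<close> \<open>l \<in> {1..a}\<close>, unfolded e]
          rp(3)[OF \<open>l' \<in> {1..a}\<close> \<open>l' \<in> {1..a}\<close>] by linarith
    qed
    show "l = l'" if "Q l = Q l'"
    proof -
      have "reading_row q (l + D) = reading_row q (l' + D)" "reading_col q (l + D) = reading_col q (l' + D)"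
        using that by (simp_all add: Q_def)
      note e = this
      show ?thesis
        using rq(3)[OF \<open>l \<in> {1..a}\<close> \<open>l \<in> {1..a}\<close>, unfolded e]
          rq(3)[OF \<open>l' \<in> {1..a}\<close> \<open>l' \<in> {1..a}\<close>] by linarith
    qed
  qed
  have PQ: "P l \<noteq> Q l'" if "l \<in> {1..a}" "l' \<in> {1..a}" for l l'
    using mem(2)[OF that(1)] mem(4)[OF that(2)] p by auto
  let ?M = "(\<lambda>l. (P l, Q l)) ` {1..a}"
  have "card ?M = a"
  proof (subst card_image)
    show "inj_on (\<lambda>l. (P l, Q l)) {1..a}"
      using inj(1) by (intro inj_onI) (simp only: prod.inject)
  qed simp
  moreover have "?M \<subseteq> diagram \<kappa> \<times> diagram \<kappa>" "\<forall>(s, t)\<in>?M. T s = p \<and> T t = q \<and> northeast s t"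
    using mem ne by (simp_all add: image_subset_iff)
  moreover have "pairwise (\<lambda>(s, t) (s', t'). disjnt {s, t} {s', t'}) ?M"
  proof (rule pairwiseI)
    fix m m' assume "m \<in> ?M" "m' \<in> ?M" "m \<noteq> m'"
    then obtain l l' where l: "l \<in> {1..a}" "l' \<in> {1..a}" "m = (P l, Q l)" "m' = (P l', Q l')" "l \<noteq> l'"
      by blast
    have "P l \<noteq> P l'" "Q l \<noteq> Q l'"
      using inj[OF l(1,2)] l(5) by blast+
    then show "(\<lambda>(s, t) (s', t'). disjnt {s, t} {s', t'}) m m'"
      using PQ[OF l(1,2)] PQ[OF l(2,1)] unfolding l(3,4) by (simp add: disjnt_def eq_commute)
  qed
  ultimately show ?thesis
    unfolding has_ne_pairs_def by (intro exI[of _ ?M]) simp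
qed

end

section \<open>The hive of a tableau\<close>

lemma int_card_common_columns:
  assumes "\<beta> ! i \<le> \<beta> ! (i - 1)" "\<alpha> ! i \<le> \<alpha> ! (i - 1)"
  shows "int (common_columns \<alpha> \<beta> i) = max 0 (\<alpha> ! i - \<beta> ! (i - 1))"
proof -
  have "{\<beta> ! (i - 1) <.. \<alpha> ! (i - 1)} \<inter> {\<beta> ! i <.. \<alpha> ! i} = {\<beta> ! (i - 1) <.. \<alpha> ! i}"
    using assms by auto
  then show ?thesis
    by (simp add: common_columns_def)
qed

lemma shuffle_nth_diff:
  assumes "1 \<le> \<bar>k\<bar>" "\<bar>k\<bar> \<le> int n" "p < 2 * n"
    and "length \<alpha> = n" "length \<alpha>' = n" "length \<beta> = n" "length \<beta>' = n"
  shows "shuffle n k (map2 (-) \<alpha> \<alpha>') (map2 (-) \<beta> \<beta>') ! p = shuffle n k \<alpha> \<beta> ! p - shuffle n k \<alpha>' \<beta>' ! p"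
proof -
  let ?P = "phased_path n k"
  have len: "length ?P = 2 * n"
    using length_phased_path[OF assms(1,2)] .
  have "count_list (take p ?P) (?P ! p) < count_list ?P (?P ! p)"
    using count_list_take_mono[of "Suc p" "length ?P" ?P "?P ! p"] count_list_take_Suc[of p ?P "?P ! p"]
      assms(3) len by simp
  then have "count_list (take p ?P) (?P ! p) < n"
    using count_phased_path[OF assms(1,2)] by simp
  then show ?thesis
    using assms(3-) len by (cases "?P ! p") (simp_all add: shuffle_def Let_def)
qed

context bounded_tableau
begin

lemma cells_le_total: "cells v j \<le> cells v N"
  using cells_mono[of j N v] cells_stable_N[of j v] by (cases "j \<le> N") auto

text \<open>
  In the application \<open>l\<close>, \<open>l'\<close> are consecutive parts of an outer partition and \<open>m\<close>, \<open>m'\<close> of the inner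
  one. Rows from \<open>p\<close> on contain no entry \<open>p\<close>, and there the inequalities follow from \<open>l' \<le> l\<close>. If
  \<open>l' < m\<close> no pairs are required, so only the inequalities need an argument; then the number of all
  entries \<open>q\<close> is at most \<open>m - m'\<close>. Otherwise the number of entries \<open>q\<close> that may stay unmatched is
  exactly \<open>m - m'\<close>.
\<close>

lemma ne_pairs_iff:
  assumes p: "1 \<le> p" and q: "q = p + 1 \<or> q = p + 2" "q \<le> N"
    and content: "cells p N = l - m" "cells q N = l' - m'" and part: "l' \<le> l" "m' \<le> m"
    and a: "int a = max 0 (l' - m)"
  shows "has_ne_pairs \<kappa> T a p q \<longleftrightarrow> (\<forall>j<p. cells q (Suc j) \<le> cells p j + (m - m') \<and>
    cells q (Suc j) + x q (Suc (Suc j)) \<le> cells p j + x p (Suc j) + (m - m'))"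
proof
  assume "has_ne_pairs \<kappa> T a p q"
  note * = ineqs_of_ne_pairs[OF p q(1) this]
  have "cells q N - int a \<le> m - m'"
    using content(2) a by simp
  then show "\<forall>j<p. cells q (Suc j) \<le> cells p j + (m - m') \<and>
      cells q (Suc j) + x q (Suc (Suc j)) \<le> cells p j + x p (Suc j) + (m - m')"
    using * by (meson add_left_mono order_trans)
next
  assume small: "\<forall>j<p. cells q (Suc j) \<le> cells p j + (m - m') \<and>
      cells q (Suc j) + x q (Suc (Suc j)) \<le> cells p j + x p (Suc j) + (m - m')"
  have large: "cells q (Suc j) + x q (Suc (Suc j)) \<le> cells p j + (m - m')" if "p \<le> j" for j
  proof -
    have "x (q - 1) (Suc (Suc j)) = 0"
      using that q(1) by (intro x_eq_0) auto
    then have "cells q (Suc j) + x q (Suc (Suc j)) = cells q (Suc (Suc j))"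
      using cells_Suc[of q "Suc j"] by simp
    moreover have "cells p j = cells p N"
      using cells_stable[OF that] cells_stable[of p N] q by auto
    ultimately show ?thesis
      using cells_le_total[of q "Suc (Suc j)"] content part by simp
  qed
  have rows: "cells q (Suc j) \<le> cells p j + (m - m')" for j
    using small large[of j] x_nonneg[of q "Suc (Suc j)"] by (cases "j < p") auto
  have cols: "cells q (Suc j) + x q (Suc (Suc j)) \<le> cells p j + x p (Suc j) + (m - m')" for j
    using small large[of j] x_nonneg[of p "Suc j"] by (cases "j < p") auto
  show "has_ne_pairs \<kappa> T a p q"
  proof (cases "a = 0")
    case True
    then show ?thesis
      unfolding has_ne_pairs_def by (intro exI[of _ "{}"]) simp
  next
    case False
    then have "int a + (m - m') \<le> cells q N"
      using a content(2) by simp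
    then show ?thesis
      using p q(1) part by (intro ne_pairs_of_ineqs[OF p _ _ _ rows cols]) auto
  qed
qed

lemma has_content_iff:
  assumes "length \<gamma> = N"
  shows "has_content \<kappa> T \<gamma> \<longleftrightarrow> (\<forall>v. 1 \<le> v \<and> v \<le> N \<longrightarrow> cells v N = \<gamma> ! (v - 1))"
proof -
  have large: "card {s \<in> diagram \<kappa>. T s = v} = 0" if "N < v" for v
  proof -
    have none: "{s \<in> diagram \<kappa>. T s = v} = {}"
      using le_N that by fastforce
    show ?thesis
      unfolding none by simp
  qed
  have "int (card {s \<in> diagram \<kappa>. T s = v}) = (if v \<le> length \<gamma> then \<gamma> ! (v - 1) else 0) \<longleftrightarrow>
      (v \<le> N \<longrightarrow> cells v N = \<gamma> ! (v - 1))" if "1 \<le> v" for v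
    using card_entries[OF that] large[of v] assms by (cases "v \<le> N") simp_all
  then show ?thesis
    unfolding has_content_def by blast
qed

definition prefix_sum :: "nat \<Rightarrow> nat \<Rightarrow> int" where
  "prefix_sum m j = (\<Sum>a = 1..j. x m a)"

lemma prefix_sum_simps:
  "prefix_sum m 0 = 0" "prefix_sum m (Suc j) = prefix_sum m j + x m (Suc j)"
  by (simp_all add: prefix_sum_def)

lemma prefix_sum_Suc_level: "prefix_sum (Suc m) j = prefix_sum m j + cells (Suc m) j"
  by (simp add: prefix_sum_def cells_def sum_subtractf)

end

locale phased_data =
  fixes n :: nat and k :: int and lam \<mu> \<nu> \<rho> \<kappa> :: "int list"
  assumes parts: "part_seq n lam" "part_seq n \<mu>" "part_seq n \<nu>" "part_seq n \<rho>" "part_seq (2 * n) \<kappa>"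
    and k: "1 \<le> \<bar>k\<bar>" "\<bar>k\<bar> \<le> int n"
begin

abbreviation P where "P \<equiv> phased_path n k"
abbreviation outer where "outer \<equiv> shuffle n k lam \<nu>"
abbreviation inner where "inner \<equiv> shuffle n k \<mu> \<rho>"
abbreviation content where "content \<equiv> shuffle n k (map2 (-) lam \<mu>) (map2 (-) \<nu> \<rho>)"

lemma lengths: "length lam = n" "length \<mu> = n" "length \<nu> = n" "length \<rho> = n"
  using parts(1-4)[THEN part_seq_nth(1)] .

lemma content_nth: "p < 2 * n \<Longrightarrow> content ! p = outer ! p - inner ! p"
  using shuffle_nth_diff[OF k _ lengths(1,2,3,4)] .

lemma linked_values:
  assumes "1 \<le> i" "i < n" and p: "p = letter_pos P c i" and q: "q = letter_pos P c (i + 1)"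
    and \<alpha>\<beta>: "\<alpha> = (if c = West then lam else \<nu>)" "\<beta> = (if c = West then \<mu> else \<rho>)"
  shows "outer ! (p - 1) = \<alpha> ! (i - 1)" "outer ! (q - 1) = \<alpha> ! i"
    "inner ! (p - 1) = \<beta> ! (i - 1)" "inner ! (q - 1) = \<beta> ! i"
    "\<alpha> ! i \<le> \<alpha> ! (i - 1)" "\<beta> ! i \<le> \<beta> ! (i - 1)"
proof -
  show "outer ! (p - 1) = \<alpha> ! (i - 1)" "inner ! (p - 1) = \<beta> ! (i - 1)"
    unfolding p \<alpha>\<beta> by (rule shuffle_letter_pos[OF k]; use assms(1,2) in linarith)+
  show "outer ! (q - 1) = \<alpha> ! i" "inner ! (q - 1) = \<beta> ! i"
    using shuffle_letter_pos[OF k, of "i + 1" lam \<nu> c] shuffle_letter_pos[OF k, of "i + 1" \<mu> \<rho> c] assms(1,2)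
    unfolding q \<alpha>\<beta> by simp_all
  have "part_seq n \<alpha>" "part_seq n \<beta>"
    using parts by (simp_all add: \<alpha>\<beta>)
  then show "\<alpha> ! i \<le> \<alpha> ! (i - 1)" "\<beta> ! i \<le> \<beta> ! (i - 1)"
    using part_seq_nth(3)[of n _ "i - 1" i] assms(1,2) by simp_all
qed

end

locale phased_tableau = phased_data + bounded_tableau "2 * n" \<kappa> T for T
begin

abbreviation h where "h \<equiv> tableau_hive n k \<mu> \<rho> \<kappa> T"

definition inner_sum :: "nat \<Rightarrow> int" where
  "inner_sum m = (\<Sum>a = 1..m. inner ! (a - 1))"

lemma inner_sum_Suc: "inner_sum (Suc m) = inner_sum m + inner ! m"
  by (simp add: inner_sum_def)

lemma h_eq: "i + j \<le> 2 * n \<Longrightarrow> h (i, j) = prefix_sum (i + j) j + inner_sum (i + j)"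
  by (simp add: tableau_hive_def Delta_def y_entry_def prefix_sum_def inner_sum_def)

lemma edge_right_h: "edge_right (2 * n) h = inner"
proof (rule nth_equalityI)
  fix i assume "i < length (edge_right (2 * n) h)"
  then have "i < 2 * n"
    by (simp add: edge_right_def)
  then show "edge_right (2 * n) h ! i = inner ! i"
    using h_eq[of i 0] h_eq[of "Suc i" 0] by (simp add: edge_right_def prefix_sum_simps inner_sum_Suc)
qed (simp add: edge_right_def length_shuffle[OF k])

lemma edge_nw_h: "edge_nw (2 * n) h = \<kappa>"
proof (rule nth_equalityI)
  show "length (edge_nw (2 * n) h) = length \<kappa>"
    using part_seq_nth(1)[OF shape] by (simp add: edge_nw_def)
next
  fix j assume "j < length (edge_nw (2 * n) h)"
  then have "j < 2 * n"
    by (simp add: edge_nw_def)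
  then show "edge_nw (2 * n) h ! j = \<kappa> ! j"
    using h_eq[of "2 * n - Suc j" "Suc j"] h_eq[of "2 * n - j" j] x_last[of "Suc j" "2 * n"]
    by (simp add: edge_nw_def prefix_sum_simps)
qed

lemma edge_up_h:
  assumes "j < 2 * n"
  shows "edge_up (2 * n) h ! j = cells (Suc j) (2 * n) + inner ! j"
proof -
  have "x j (Suc j) = 0"
    by (rule x_eq_0) simp
  then have "h (0, Suc j) - h (0, j) = cells (Suc j) (Suc j) + inner ! j"
    using h_eq[of 0 "Suc j"] h_eq[of 0 j] assms prefix_sum_Suc_level[of j "Suc j"] prefix_sum_simps(2)[of j j]
    by (simp add: inner_sum_Suc)
  then show ?thesis
    using assms cells_stable[of "Suc j" "2 * n"] by (simp add: edge_up_def)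
qed

lemma edge_up_iff:
  "edge_up (2 * n) h = outer \<longleftrightarrow> has_content \<kappa> T content"
proof -
  have "edge_up (2 * n) h = outer \<longleftrightarrow> (\<forall>j<2 * n. cells (Suc j) (2 * n) + inner ! j = outer ! j)"
    using edge_up_h by (auto simp: list_eq_iff_nth_eq length_shuffle[OF k] edge_up_def)
  also have "\<dots> \<longleftrightarrow> (\<forall>j<2 * n. cells (Suc j) (2 * n) = content ! j)"
  proof -
    have "cells (Suc j) (2 * n) + inner ! j = outer ! j \<longleftrightarrow> cells (Suc j) (2 * n) = content ! j"
      if "j < 2 * n" for j
      using content_nth[OF that] by linarith
    then show ?thesis by blast
  qed
  also have "\<dots> \<longleftrightarrow> (\<forall>v. 1 \<le> v \<and> v \<le> 2 * n \<longrightarrow> cells v (2 * n) = content ! (v - 1))"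
  proof (intro iffI allI impI)
    fix v assume "\<forall>j<2 * n. cells (Suc j) (2 * n) = content ! j" "1 \<le> v \<and> v \<le> 2 * n"
    then show "cells v (2 * n) = content ! (v - 1)"
      by (cases v) auto
  next
    fix j assume *: "\<forall>v. 1 \<le> v \<and> v \<le> 2 * n \<longrightarrow> cells v (2 * n) = content ! (v - 1)" "j < 2 * n"
    then show "cells (Suc j) (2 * n) = content ! j"
      using spec[OF *(1), of "Suc j"] by simp
  qed
  finally show ?thesis
    using has_content_iff[of content] length_shuffle[OF k] by simp
qed

definition linked_ineqs :: "nat \<Rightarrow> nat \<Rightarrow> bool" where
  "linked_ineqs p q \<longleftrightarrow> (\<forall>j<p.
     cells q (Suc j) \<le> cells p j + (inner ! (p - 1) - inner ! (q - 1)) \<and>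
     cells q (Suc j) + x q (Suc (Suc j)) \<le> cells p j + x p (Suc j) + (inner ! (p - 1) - inner ! (q - 1)))"

lemma linked_range: "linked P p q \<Longrightarrow> 1 \<le> p \<and> p < q \<and> q \<le> 2 * n"
  using length_phased_path[OF k] linkedD[of P p q] by linarith

text \<open>
  Substituting partial sums of rows into the inequalities of a hive, those between levels \<open>p\<close> and \<open>q\<close>
  become the matching conditions. For adjacent levels the hive provides only the first one, and the
  second follows from it by interlacing.
\<close>

lemma phased_hive_h_iff:
  "phased_hive n k h \<longleftrightarrow> (\<forall>p q. linked P p q \<longrightarrow> linked_ineqs p q)"
proof -
  have ext: "h \<in> extensional (Delta (2 * n))"
    by (simp add: tableau_hive_def)
  have A: "h (i, j + 2) + h (i + 1, j) \<le> h (i, j + 1) + h (i + 1, j + 1)"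
    "h (i + 2, j) + h (i, j + 1) \<le> h (i + 1, j) + h (i + 1, j + 1)" if "i + j + 2 \<le> 2 * n" for i j
    using that x_interlace[of "Suc j" "Suc (i + j)"] x_mono[of "Suc (i + j)" "Suc (Suc (i + j))" "Suc j"]
      h_eq[of i "Suc (Suc j)"] h_eq[of "Suc i" j] h_eq[of i "Suc j"] h_eq[of "Suc i" "Suc j"] h_eq[of "Suc (Suc i)" j]
    by (simp_all add: prefix_sum_simps)
  have B: "h (i, j) + h (i + 1, j + 1) \<le> h (i, j + 1) + h (i + 1, j) \<longleftrightarrow>
      cells q (Suc j) \<le> cells p j + (inner ! (p - 1) - inner ! (q - 1))"
    if "p = i + j + 1" "q = i + j + 2" "q \<le> 2 * n" for i j p q
    using that h_eq[of i j] h_eq[of "Suc i" "Suc j"] h_eq[of i "Suc j"] h_eq[of "Suc i" j]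
    by (auto simp: prefix_sum_Suc_level prefix_sum_simps(1) inner_sum_Suc)
  have C1: "h (i, j) + h (i + 1, j + 2) \<le> h (i, j + 1) + h (i + 1, j + 1) \<longleftrightarrow>
      cells q (Suc j) + x q (Suc (Suc j)) \<le> cells p j + x p (Suc j) + (inner ! (p - 1) - inner ! (q - 1))"
    if "p = i + j + 1" "q = i + j + 3" "q \<le> 2 * n" for i j p q
  proof -
    have "prefix_sum q (Suc (Suc j)) = prefix_sum (Suc p) (Suc j) + cells q (Suc j) + x q (Suc (Suc j))"
      "prefix_sum p (Suc j) = prefix_sum (i + j) j + cells p j + x p (Suc j)"
      "inner_sum q = inner_sum (Suc p) + inner ! (q - 1)" "inner_sum p = inner_sum (i + j) + inner ! (p - 1)"
      using that prefix_sum_Suc_level[of "Suc p" "Suc j"] prefix_sum_Suc_level[of "i + j" j]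
      by (simp_all add: prefix_sum_simps inner_sum_Suc numeral_eq_Suc)
    moreover have "h (i, j) = prefix_sum (i + j) j + inner_sum (i + j)"
      "h (i + 1, j + 2) = prefix_sum q (Suc (Suc j)) + inner_sum q"
      "h (i, j + 1) = prefix_sum p (Suc j) + inner_sum p"
      "h (i + 1, j + 1) = prefix_sum (Suc p) (Suc j) + inner_sum (Suc p)"
      using that by (simp_all add: h_eq numeral_eq_Suc)
    ultimately show ?thesis
      by linarith
  qed
  have C2: "h (i, j) + h (i + 2, j + 1) \<le> h (i + 1, j) + h (i + 1, j + 1) \<longleftrightarrow>
      cells q (Suc j) \<le> cells p j + (inner ! (p - 1) - inner ! (q - 1))"
    if "p = i + j + 1" "q = i + j + 3" "q \<le> 2 * n" for i j p q
  proof -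
    have "prefix_sum q (Suc j) = prefix_sum (Suc p) (Suc j) + cells q (Suc j)"
      "prefix_sum p j = prefix_sum (i + j) j + cells p j"
      "inner_sum q = inner_sum (Suc p) + inner ! (q - 1)" "inner_sum p = inner_sum (i + j) + inner ! (p - 1)"
      using that prefix_sum_Suc_level[of "Suc p" "Suc j"] prefix_sum_Suc_level[of "i + j" j]
      by (simp_all add: inner_sum_Suc numeral_eq_Suc)
    moreover have "h (i, j) = prefix_sum (i + j) j + inner_sum (i + j)"
      "h (i + 2, j + 1) = prefix_sum q (Suc j) + inner_sum q"
      "h (i + 1, j) = prefix_sum p j + inner_sum p"
      "h (i + 1, j + 1) = prefix_sum (Suc p) (Suc j) + inner_sum (Suc p)"
      using that by (simp_all add: h_eq numeral_eq_Suc)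
    ultimately show ?thesis
      by linarith
  qed
  note iff = phased_hive_iff[OF k refl refl, of h]
  show ?thesis
  proof
    assume "phased_hive n k h"
    note hive = this[unfolded iff]
    have "linked_ineqs p q" if l: "linked P p q" for p q
      unfolding linked_ineqs_def
    proof (intro allI impI)
      fix j assume "j < p"
      define i where "i = p - Suc j"
      have i: "p = i + j + 1"
        using \<open>j < p\<close> by (simp add: i_def)
      note pq = linked_range[OF l]
      consider "q = i + j + 2" | "q = i + j + 3"
        using linkedD[OF l] i by linarith
      then show "cells q (Suc j) \<le> cells p j + (inner ! (p - 1) - inner ! (q - 1)) \<and>
        cells q (Suc j) + x q (Suc (Suc j)) \<le> cells p j + x p (Suc j) + (inner ! (p - 1) - inner ! (q - 1))"
      proof cases
        case 1
        then have "h (i, j) + h (i + 1, j + 1) \<le> h (i, j + 1) + h (i + 1, j)"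
          using hive l i by blast
        then have "cells q (Suc j) \<le> cells p j + (inner ! (p - 1) - inner ! (q - 1))"
          using B[OF i 1] pq by simp
        moreover have "x q (Suc (Suc j)) \<le> x p (Suc j)"
          using x_interlace[of "Suc j" p] i 1 by simp
        ultimately show ?thesis by linarith
      next
        case 2
        then have "h (i, j) + h (i + 1, j + 2) \<le> h (i, j + 1) + h (i + 1, j + 1)"
            "h (i, j) + h (i + 2, j + 1) \<le> h (i + 1, j) + h (i + 1, j + 1)"
          using hive l i by blast+
        then show ?thesis
          using C1[OF i 2] C2[OF i 2] pq by blast
      qed
    qed
    then show "\<forall>p q. linked P p q \<longrightarrow> linked_ineqs p q" by blast
  next
    assume L: "\<forall>p q. linked P p q \<longrightarrow> linked_ineqs p q"
    show "phased_hive n k h"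
      unfolding iff
    proof (intro conjI allI impI)
      fix i j assume l: "linked P (i + j + 1) (i + j + 2)"
      then have "linked_ineqs (i + j + 1) (i + j + 2)"
        using L by blast
      then show "h (i, j) + h (i + 1, j + 1) \<le> h (i, j + 1) + h (i + 1, j)"
        using B[OF refl refl, of i j] linked_range[OF l] unfolding linked_ineqs_def by auto
    next
      fix i j assume l: "linked P (i + j + 1) (i + j + 3)"
      then have "linked_ineqs (i + j + 1) (i + j + 3)"
        using L by blast
      then have "cells (i + j + 3) (Suc j) \<le> cells (i + j + 1) j + (inner ! (i + j + 1 - 1) - inner ! (i + j + 3 - 1)) \<and>
         cells (i + j + 3) (Suc j) + x (i + j + 3) (Suc (Suc j)) \<le>
         cells (i + j + 1) j + x (i + j + 1) (Suc j) + (inner ! (i + j + 1 - 1) - inner ! (i + j + 3 - 1))"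
        unfolding linked_ineqs_def by simp
      then show "h (i, j) + h (i + 1, j + 2) \<le> h (i, j + 1) + h (i + 1, j + 1)"
          "h (i, j) + h (i + 2, j + 1) \<le> h (i + 1, j) + h (i + 1, j + 1)"
        using C1[OF refl refl, of i j] C2[OF refl refl, of i j] linked_range[OF l] by blast+
    qed (rule ext A; assumption)+
  qed
qed

lemma peelable_iff_hive:
  "T \<in> peelable_tableaux n k lam \<mu> \<nu> \<rho> \<kappa> \<longleftrightarrow> h \<in> skew_hives n k lam \<mu> \<nu> \<rho> \<kappa>"
proof -
  have pairs: "(has_ne_pairs \<kappa> T (common_columns lam \<mu> i) (letter_pos P West i) (letter_pos P West (i + 1)) \<and>
      has_ne_pairs \<kappa> T (common_columns \<nu> \<rho> i) (letter_pos P North i) (letter_pos P North (i + 1))) \<longleftrightarrow>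
      (\<forall>c. linked_ineqs (letter_pos P c i) (letter_pos P c (i + 1)))"
    if content: "has_content \<kappa> T content" and i: "1 \<le> i" "i < n" for i
  proof -
    have *: "has_ne_pairs \<kappa> T (common_columns \<alpha> \<beta> i) (letter_pos P c i) (letter_pos P c (i + 1)) \<longleftrightarrow>
        linked_ineqs (letter_pos P c i) (letter_pos P c (i + 1))"
      if \<alpha>\<beta>: "\<alpha> = (if c = West then lam else \<nu>)" "\<beta> = (if c = West then \<mu> else \<rho>)" for c \<alpha> \<beta>
    proof -
      define p q where "p = letter_pos P c i" and "q = letter_pos P c (i + 1)"
      have l: "linked P p q"
        using linked_iff[OF k refl] i unfolding p_def q_def by blast
      note r = linked_range[OF l]
      have q: "q = p + 1 \<or> q = p + 2"
        using linkedD[OF l] by blast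
      note v = linked_values[OF i p_def q_def \<alpha>\<beta>]
      have cells: "cells p (2 * n) = \<alpha> ! (i - 1) - \<beta> ! (i - 1)" "cells q (2 * n) = \<alpha> ! i - \<beta> ! i"
      proof -
        have "\<forall>v. 1 \<le> v \<and> v \<le> 2 * n \<longrightarrow> cells v (2 * n) = content ! (v - 1)"
          using content has_content_iff[of content] length_shuffle[OF k] by blast
        then have "cells p (2 * n) = content ! (p - 1)" "cells q (2 * n) = content ! (q - 1)"
          using r by (blast intro: less_imp_le order_trans)+
        then show "cells p (2 * n) = \<alpha> ! (i - 1) - \<beta> ! (i - 1)" "cells q (2 * n) = \<alpha> ! i - \<beta> ! i"
          using content_nth[of "p - 1"] content_nth[of "q - 1"] r v(1-4) by linarith+
      qed
      show ?thesis
        using ne_pairs_iff[OF _ q _ cells v(5,6) int_card_common_columns[OF v(6,5)]] r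
        unfolding linked_ineqs_def p_def[symmetric] q_def[symmetric] v(3,4) by blast
    qed
    have all: "(\<forall>c. R c) \<longleftrightarrow> R West \<and> R North" for R :: "letter \<Rightarrow> bool"
      by (metis letter.exhaust)
    show ?thesis
      unfolding all using *[of lam West \<mu>] *[of \<nu> North \<rho>] by simp
  qed
  have "(\<forall>p q. linked P p q \<longrightarrow> linked_ineqs p q) \<longleftrightarrow>
      (\<forall>i. 1 \<le> i \<and> i < n \<longrightarrow> (\<forall>c. linked_ineqs (letter_pos P c i) (letter_pos P c (i + 1))))"
    unfolding linked_iff[OF k refl] by blast
  moreover have "h (0, 0) = 0"
    using h_eq[of 0 0] by (simp add: prefix_sum_simps inner_sum_def)
  ultimately have "h \<in> skew_hives n k lam \<mu> \<nu> \<rho> \<kappa> \<longleftrightarrow> has_content \<kappa> T content \<and>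
      (\<forall>i. 1 \<le> i \<and> i < n \<longrightarrow> (\<forall>c. linked_ineqs (letter_pos P c i) (letter_pos P c (i + 1))))"
    by (auto simp: skew_hives_def phased_hive_h_iff edge_up_iff edge_right_h edge_nw_h)
  also have "\<dots> \<longleftrightarrow> T \<in> peelable_tableaux n k lam \<mu> \<nu> \<rho> \<kappa>"
    unfolding peelable_tableaux_def mem_Collect_eq using ssyt pairs by blast
  finally show ?thesis ..
qed

text \<open>
  The hive determines the pattern, hence the tableau.
\<close>

lemma x_of_h:
  assumes "1 \<le> a" "a \<le> m" "m \<le> 2 * n"
  shows "x m a = h (m - a, a) - h (m - (a - 1), a - 1)"
proof -
  obtain j where j: "a = Suc j"
    using assms(1) by (cases a) auto
  have "h (m - Suc j, Suc j) = prefix_sum m (Suc j) + inner_sum m" "h (m - j, j) = prefix_sum m j + inner_sum m"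
    using h_eq[of "m - Suc j" "Suc j"] h_eq[of "m - j" j] assms j by simp_all
  then show ?thesis
    unfolding j by (simp add: prefix_sum_simps)
qed

end

context phased_data
begin

lemma peelable_phased_tableau:
  assumes "T \<in> peelable_tableaux n k lam \<mu> \<nu> \<rho> \<kappa>"
  shows "phased_tableau n k lam \<mu> \<nu> \<rho> \<kappa> T"
proof unfold_locales
  have T: "ssyt \<kappa> T" "has_content \<kappa> T content"
    using assms by (auto simp: peelable_tableaux_def)
  show "part_seq (2 * n) \<kappa>" "ssyt \<kappa> T"
    using parts(5) T(1) .
  fix s assume s: "s \<in> diagram \<kappa>"
  show "T s \<le> 2 * n"
  proof (rule ccontr)
    assume "\<not> T s \<le> 2 * n"
    then have "int (card {t \<in> diagram \<kappa>. T t = T s}) = 0"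
      using T(2) length_shuffle[OF k] by (simp add: has_content_def)
    moreover have "finite {t \<in> diagram \<kappa>. T t = T s}"
      using finite_diagram by simp
    ultimately have none: "{t \<in> diagram \<kappa>. T t = T s} = {}"
      by simp
    have "s \<in> {t \<in> diagram \<kappa>. T t = T s}"
      using s by simp
    then show False
      unfolding none by simp
  qed
qed

lemma inj_tableau_hive:
  "inj_on (tableau_hive n k \<mu> \<rho> \<kappa>) (peelable_tableaux n k lam \<mu> \<nu> \<rho> \<kappa>)"
proof (rule inj_onI)
  fix T T' assume mem: "T \<in> peelable_tableaux n k lam \<mu> \<nu> \<rho> \<kappa>" "T' \<in> peelable_tableaux n k lam \<mu> \<nu> \<rho> \<kappa>"
    and eq: "tableau_hive n k \<mu> \<rho> \<kappa> T = tableau_hive n k \<mu> \<rho> \<kappa> T'"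
  interpret A: phased_tableau n k lam \<mu> \<nu> \<rho> \<kappa> T
    by (rule peelable_phased_tableau[OF mem(1)])
  interpret B: phased_tableau n k lam \<mu> \<nu> \<rho> \<kappa> T'
    by (rule peelable_phased_tableau[OF mem(2)])
  have x: "A.x m a = B.x m a" if "m \<le> 2 * n" for m a
  proof (cases "1 \<le> a \<and> a \<le> m")
    case True
    then show ?thesis
      using A.x_of_h[of a m] B.x_of_h[of a m] that eq by simp
  next
    case False
    then show ?thesis
      using A.x_eq_0[of m a] B.x_eq_0[of m a] by auto
  qed
  have "T (a, c) = T' (a, c)" if s: "(a, c) \<in> diagram \<kappa>" for a c
  proof -
    have "1 \<le> c"
      using s by (simp add: diagram_def)
    then have iff: "T (a, c) \<le> m \<longleftrightarrow> T' (a, c) \<le> m" if "m \<le> 2 * n" for m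
      using A.le_x_iff[of c m a] B.le_x_iff[of c m a] x[OF that] s by simp
    show ?thesis
      using iff[OF A.le_N[OF s]] iff[OF B.le_N[OF s]] by simp
  qed
  then show "T = T'"
    using A.ssyt B.ssyt by (intro extensionalityI[of T "diagram \<kappa>"]) (auto simp: ssyt_def)
qed

lemma hive_has_tableau:
  assumes "g \<in> skew_hives n k lam \<mu> \<nu> \<rho> \<kappa>"
  obtains T where "phased_tableau n k lam \<mu> \<nu> \<rho> \<kappa> T" "tableau_hive n k \<mu> \<rho> \<kappa> T = g"
proof -
  have hive: "phased_hive n k g" and g0: "g (0, 0) = 0" and right: "edge_right (2 * n) g = inner"
    and nw: "edge_nw (2 * n) g = \<kappa>"
    using assms by (auto simp: skew_hives_def)
  have ext: "g \<in> extensional (Delta (2 * n))"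
    and ineqs: "\<And>i j. i + j + 2 \<le> 2 * n \<Longrightarrow> g (i, j + 2) + g (i + 1, j) \<le> g (i, j + 1) + g (i + 1, j + 1)"
      "\<And>i j. i + j + 2 \<le> 2 * n \<Longrightarrow> g (i + 2, j) + g (i, j + 1) \<le> g (i + 1, j) + g (i + 1, j + 1)"
    using hive unfolding phased_hive_iff[OF k refl refl] by blast+
  define z where "z = (\<lambda>m a. g (m - a, a) - g (m - (a - 1), a - 1))"
  have split: "\<exists>i j. m = i + j + 1 \<and> a = j + 1" if "1 \<le> a" "a \<le> m" for m a :: nat
    using that by (intro exI[of _ "m - a"] exI[of _ "a - 1"]) simp
  have mono: "z m a \<le> z (Suc m) a" and inter: "z (Suc m) (Suc a) \<le> z m a"
    if a: "1 \<le> a" "a \<le> m" and m: "m < 2 * n" for m a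
  proof -
    obtain i j where ij: "m = i + j + 1" "a = j + 1"
      using split[OF a] by blast
    have "Suc (i + j) - j = Suc i" "Suc (Suc (i + j)) - j = Suc (Suc i)"
      by simp_all
    then show "z m a \<le> z (Suc m) a" "z (Suc m) (Suc a) \<le> z m a"
      using ineqs[of i j] m by (simp_all add: z_def ij numeral_2_eq_2)
  qed
  have last: "z (2 * n) a = \<kappa> ! (a - 1)" if "1 \<le> a" "a \<le> 2 * n" for a
  proof -
    obtain j where "a = Suc j"
      using \<open>1 \<le> a\<close> by (cases a) auto
    then have "edge_nw (2 * n) g ! (a - 1) = z (2 * n) a"
      using that by (simp add: edge_nw_def z_def)
    then show ?thesis by (simp add: nw)
  qed
  obtain T where T: "bounded_tableau (2 * n) \<kappa> T"
    and x: "\<And>m a. 1 \<le> a \<Longrightarrow> a \<le> m \<Longrightarrow> m \<le> 2 * n \<Longrightarrow> sub_shape \<kappa> T m a = z m a"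
    using tableau_of_pattern[of "2 * n" \<kappa> z, OF parts(5) mono inter last] by blast
  interpret phased_tableau n k lam \<mu> \<nu> \<rho> \<kappa> T
    by (intro phased_tableau.intro phased_data_axioms T)
  have bottom: "g (m, 0) = inner_sum m" if "m \<le> 2 * n" for m
    using that
  proof (induction m)
    case (Suc m)
    then have "edge_right (2 * n) g ! m = g (Suc m, 0) - g (m, 0)"
      by (simp add: edge_right_def)
    then show ?case
      using Suc by (simp add: right inner_sum_Suc)
  qed (simp add: g0 inner_sum_def)
  have level: "g (m - j, j) = prefix_sum m j + inner_sum m" if "j \<le> m" "m \<le> 2 * n" for m j
    using that(1)
  proof (induction j)
    case (Suc j)
    then show ?case
      using x[of "Suc j" m] that(2) by (simp add: z_def prefix_sum_simps)
  qed (use bottom that in \<open>simp add: prefix_sum_simps\<close>)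
  have "h = g"
  proof (rule extensionalityI[of _ "Delta (2 * n)"])
    fix s assume "s \<in> Delta (2 * n)"
    then show "h s = g s"
      using h_eq[of "fst s" "snd s"] level[of "snd s" "fst s + snd s"] by (cases s) (simp add: Delta_def)
  qed (simp_all add: ext tableau_hive_def)
  then show ?thesis
    using that phased_tableau_axioms by blast
qed

end

theorem mainTheorem6:
  fixes n :: nat and k :: int and lam \<mu> \<nu> \<rho> \<kappa> :: "int list"
  assumes "n \<ge> 1"
    and "part_seq n lam" and "part_seq n \<mu>" and "part_seq n \<nu>" and "part_seq n \<rho>"
    and "part_seq (2 * n) \<kappa>"
    and "1 \<le> \<bar>k\<bar>" and "\<bar>k\<bar> \<le> int n"
  shows "bij_betw (tableau_hive n k \<mu> \<rho> \<kappa>)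
           (peelable_tableaux n k lam \<mu> \<nu> \<rho> \<kappa>)
           (skew_hives n k lam \<mu> \<nu> \<rho> \<kappa>)"
proof -
  interpret phased_data n k lam \<mu> \<nu> \<rho> \<kappa>
    using assms by unfold_locales
  show ?thesis
  proof (rule bij_betw_imageI[OF inj_tableau_hive equalityI])
    show "tableau_hive n k \<mu> \<rho> \<kappa> ` peelable_tableaux n k lam \<mu> \<nu> \<rho> \<kappa> \<subseteq> skew_hives n k lam \<mu> \<nu> \<rho> \<kappa>"
      using phased_tableau.peelable_iff_hive[OF peelable_phased_tableau] by blast
    show "skew_hives n k lam \<mu> \<nu> \<rho> \<kappa> \<subseteq> tableau_hive n k \<mu> \<rho> \<kappa> ` peelable_tableaux n k lam \<mu> \<nu> \<rho> \<kappa>"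
    proof
      fix g assume g: "g \<in> skew_hives n k lam \<mu> \<nu> \<rho> \<kappa>"
      then obtain T where T: "phased_tableau n k lam \<mu> \<nu> \<rho> \<kappa> T" "tableau_hive n k \<mu> \<rho> \<kappa> T = g"
        by (rule hive_has_tableau)
      then show "g \<in> tableau_hive n k \<mu> \<rho> \<kappa> ` peelable_tableaux n k lam \<mu> \<nu> \<rho> \<kappa>"
        using phased_tableau.peelable_iff_hive[OF T(1)] g by blast
    qed
  qed
qed

end
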